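(* Let $V$ be a set of $n$ i.i.d. uniform random points in $[0,1]^2$, let $k$ be any integer in $[1,n]$, and let the depot $O$ be any fixed point of $\mathbb{R}^2$. For any constant $\alpha\ge 1$ and any $\alpha$-approximate traveling salesman tour $T$ on $V\cup\{O\}$, asymptotically almost surely $$\frac{\mathrm{ITP}(T)}{\mathrm{OPT}}\ \le\ 0.915+\alpha .$$
   Context: Unit-demand Euclidean capacitated vehicle routing problem (CVRP): given a set $V$ of $n$ customer points in $\mathbb{R}^2$, a depot $O\in\mathbb{R}^2$ and an integer capacity $k\in[1,n]$, find a collection of tours, each starting and ending at $O$ and visiting at most $k$ points of $V$, covering all of $V$, of minimum total Euclidean length; $\mathrm{OPT}$ denotes this minimum. A traveling salesman tour $T$ on $V\cup\{O\}$ is $\alpha$-approximate if its cost is at most $\alpha$ times the cost of an optimal traveling salesman tour on $V\cup\{O\}$. Iterated tour partitioning (ITP): write $T=(O,x_1,\dots,x_n,O)$. For each $i\in\{1,\dots,k\}$ let $n_i=\lceil (n-i)/k\rceil+1$ and let $S_i$ consist of the tours $(O,x_1,\dots,x_i,O)$, $(O,x_{i+1},\dots,x_{i+k},O)$, $\dots$, $(O,x_{i+(n_i-2)k+1},\dots,x_n,O)$. Then $\mathrm{ITP}(T)=\min_{1\le i\le k}\mathrm{cost}(S_i)$. An event occurs asymptotically almost surely (a.a.s.) if its probability tends to $1$ as $n\to\infty$. *)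

theory Defs
  imports "HOL-Probability.Probability"
begin

type_synonym point = "real \<times> real"

fun walk_len :: "point list \<Rightarrow> real" where
  "walk_len (p # q # ps) = dist p q + walk_len (q # ps)"
| "walk_len _ = 0"

definition tour_cost :: "point \<Rightarrow> point list \<Rightarrow> real" where
  "tour_cost dep ys = walk_len (dep # ys @ [dep])"

text \<open>Orderings of the customer indices 0..n-1 (a TSP tour on V u {O} starting at O).\<close>
definition is_ordering :: "nat \<Rightarrow> nat list \<Rightarrow> bool" where
  "is_ordering n \<sigma> \<longleftrightarrow> distinct \<sigma> \<and> set \<sigma> = {..<n}"

definition tsp_opt :: "point \<Rightarrow> (nat \<Rightarrow> point) \<Rightarrow> nat \<Rightarrow> real" where
  "tsp_opt dep x n = Min ((\<lambda>\<sigma>. tour_cost dep (map x \<sigma>)) ` {\<sigma>. is_ordering n \<sigma>})"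

definition cvrp_opt :: "point \<Rightarrow> (nat \<Rightarrow> point) \<Rightarrow> nat \<Rightarrow> nat \<Rightarrow> real" where
  "cvrp_opt dep x n k = Inf {(\<Sum>t\<leftarrow>tours. tour_cost dep (map x t)) | tours.
       (\<forall>t\<in>set tours. length t \<le> k) \<and> (\<Union>t\<in>set tours. set t) = {..<n}}"

function chunks :: "nat \<Rightarrow> 'a list \<Rightarrow> 'a list list" where
  "chunks k xs = (if k = 0 \<or> xs = [] then [] else take k xs # chunks k (drop k xs))"
  by pat_completeness auto
termination by (relation "Wellfounded.measure (\<lambda>(k, xs). length xs)") auto

definition itp_part_cost :: "point \<Rightarrow> nat \<Rightarrow> point list \<Rightarrow> nat \<Rightarrow> real" where
  "itp_part_cost dep k ys i =
     tour_cost dep (take i ys) + (\<Sum>c\<leftarrow>chunks k (drop i ys). tour_cost dep c)"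

definition ITP :: "point \<Rightarrow> nat \<Rightarrow> point list \<Rightarrow> real" where
  "ITP dep k ys = Min (itp_part_cost dep k ys ` {1..k})"

definition unif_points :: "nat \<Rightarrow> (nat \<Rightarrow> point) measure" where
  "unif_points n = PiM {..<n} (\<lambda>_. uniform_measure lborel ({0..1} \<times> {0..1}))"

end

theory Submission
  imports Defs "HOL-Real_Asymp.Real_Asymp"
begin

text \<open>Averaging over the k partitions gives ITP(T) at most R + cost(T), where R is 2/k times the
  sum of the distances to the depot. Both R and the optimal tour length A are at most OPT, so it
  suffices that OPT exceeds R by 0.085 A whenever A > 0.915 OPT. A tour of cost C through m customers
  at distances d_j has m C - 2 (d_1 + ... + d_m) at least quadratic in its number of long edges,
  because C dominates d_i + d_j plus the length of the part of the tour between customers i and j.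
  Among n random points only few pairs have distance below s / sqrt n, namely about pi s^2 n / 2 by
  Chebyshev's inequality, so most edges are long, and OPT exceeds R by at least 0.14 sqrt n. Few's strip
  argument bounds A by sqrt (2 n) + O(1), and 0.085 sqrt 2 < 0.14.\<close>

section \<open>Walks and tours\<close>

text \<open>The obstacle is the number of tours: a tour through m customers has only m - 1 edges
  between customers, so each tour may lose one long edge. In the case A > 0.915 OPT this is
  harmless, because OPT is then O(sqrt n). With e = n powr (-1/4), tours whose first customer is at
  distance at least e from the depot cost at least 2 e each, so there are O(n^(3/4)) of them; the
  others have distinct customers in a disc that holds O(sqrt n) points on average. The quadratic
  bound for a tour, divided by m, is replaced by a tangent that is linear in m and in the number of
  long edges, so that tours of different sizes can be added up. The best slope is the proportion of
  long edges, about 1 - pi s^2 / 2. A single threshold s would gain s (1 - pi s^2 / 2)^2 / 2 per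
  sqrt n, at most about 0.114, which is below 0.085 sqrt 2 = 0.1202. Hence two thresholds are used
  together.\<close>

lemma walk_len_nonneg: "0 \<le> walk_len ps"
  by (induction ps rule: walk_len.induct) auto

lemma walk_len_append:
  assumes "xs \<noteq> []" "ys \<noteq> []"
  shows "walk_len (xs @ ys) = walk_len xs + dist (last xs) (hd ys) + walk_len ys"
  using assms
proof (induction xs rule: walk_len.induct)
  case ("2_2" p)
  then show ?case by (cases ys) auto
qed auto

lemma tour_cost_Nil [simp]: "tour_cost dep [] = 0"
  by (simp add: tour_cost_def)

lemma tour_cost_eq:
  assumes "ps \<noteq> []"
  shows "tour_cost dep ps = dist dep (hd ps) + walk_len ps + dist dep (last ps)"
proof -
  have "walk_len (dep # ps) = dist dep (hd ps) + walk_len ps"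
    using assms by (cases ps) auto
  moreover have "walk_len ((dep # ps) @ [dep]) = walk_len (dep # ps) + dist (last ps) dep"
    using assms by (subst walk_len_append) auto
  ultimately show ?thesis by (simp add: tour_cost_def dist_commute)
qed

lemma tour_cost_nonneg: "0 \<le> tour_cost dep ps"
  by (simp add: tour_cost_def walk_len_nonneg)

lemma tour_cost_append:
  assumes "xs \<noteq> []" "ys \<noteq> []"
  shows "tour_cost dep xs + tour_cost dep ys =
         tour_cost dep (xs @ ys) + (dist dep (last xs) + dist dep (hd ys) - dist (last xs) (hd ys))"
  using assms by (simp add: tour_cost_eq walk_len_append)

lemma tour_cost_append_le:
  "tour_cost dep (xs @ ys) \<le> tour_cost dep xs + tour_cost dep ys"
proof (cases "xs = [] \<or> ys = []")
  case False
  then show ?thesis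
    using tour_cost_append[of xs ys dep] dist_triangle3[of "last xs" "hd ys" dep] by simp
qed auto

lemma tour_cost_concat_le:
  "tour_cost dep (concat pss) \<le> (\<Sum>ps\<leftarrow>pss. tour_cost dep ps)"
proof (induction pss)
  case (Cons ps pss)
  then show ?case using tour_cost_append_le[of dep ps "concat pss"] by simp
qed simp

text \<open>Skipping a stop is a shortcut by the triangle inequality. The start \<open>p\<close> is
  arbitrary because every kept stop becomes the start of the remaining walk.\<close>

lemma walk_len_Cons_filter_le:
  "walk_len (p # map x (filter P t) @ [q]) \<le> walk_len (p # map x t @ [q])"
proof (induction t arbitrary: p)
  case (Cons i t)
  show ?case
  proof (cases "P i")
    case True
    then show ?thesis using Cons[of "x i"] by simp
  next
    case False
    \<comment> \<open>\<open>r\<close> is the stop after \<open>x i\<close>; the final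
      \<open>q\<close> guarantees that there is one.\<close>
    obtain r rs where r: "map x t @ [q] = r # rs" by (cases "map x t @ [q]") auto
    have "walk_len (p # map x t @ [q]) \<le> walk_len (p # x i # map x t @ [q])"
      using dist_triangle[of p r "x i"] by (simp add: r)
    then show ?thesis using False Cons[of p] by simp
  qed
qed simp

lemma tour_cost_filter_le: "tour_cost dep (map x (filter P t)) \<le> tour_cost dep (map x t)"
  unfolding tour_cost_def by (rule walk_len_Cons_filter_le)

lemma walk_len_Cons_remdups_le:
  "walk_len (p # map x (remdups t) @ [q]) \<le> walk_len (p # map x t @ [q])"
proof (induction t arbitrary: p)
  case (Cons i t)
  show ?case
  proof (cases "i \<in> set t")
    case False
    then show ?thesis using Cons[of "x i"] by simp
  next
    case True
    obtain r rs where r: "map x t @ [q] = r # rs" by (cases "map x t @ [q]") auto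
    have "walk_len (p # map x t @ [q]) \<le> walk_len (p # x i # map x t @ [q])"
      using dist_triangle[of p r "x i"] by (simp add: r)
    then show ?thesis using True Cons[of p] by simp
  qed
qed simp

lemma tour_cost_remdups_le: "tour_cost dep (map x (remdups t)) \<le> tour_cost dep (map x t)"
  unfolding tour_cost_def by (rule walk_len_Cons_remdups_le)

section \<open>The cost of iterated tour partitioning\<close>

declare chunks.simps [simp del]

text \<open>The extra cost of returning to the depot between positions \<open>j - 1\<close> and
  \<open>j\<close>, known as the saving of Clarke and Wright. It is meaningful for 1 \<le>
  \<open>j\<close> < \<open>length ps\<close>.\<close>

definition detour :: "point \<Rightarrow> point list \<Rightarrow> nat \<Rightarrow> real" where
  "detour dep ps j = dist dep (ps ! (j - 1)) + dist dep (ps ! j) - dist (ps ! (j - 1)) (ps ! j)"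

text \<open>Cutting the tour at every position leaves one round trip per customer.\<close>

lemma sum_detour:
  assumes "ps \<noteq> []"
  shows "(\<Sum>j\<in>{1..<length ps}. detour dep ps j) = 2 * (\<Sum>p\<leftarrow>ps. dist dep p) - tour_cost dep ps"
  using assms
proof (induction ps)
  case (Cons p ps)
  show ?case
  proof (cases "ps = []")
    case True
    then show ?thesis by (simp add: tour_cost_eq)
  next
    case False
    have "(\<Sum>j\<in>{1..<length (p # ps)}. detour dep (p # ps) j)
        = detour dep (p # ps) 1 + (\<Sum>j\<in>{Suc 1..<Suc (length ps)}. detour dep (p # ps) j)"
      using False by (subst sum.atLeast_Suc_lessThan) auto
    also have "(\<Sum>j\<in>{Suc 1..<Suc (length ps)}. detour dep (p # ps) j)
        = (\<Sum>j\<in>{1..<length ps}. detour dep ps j)"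
      unfolding sum.shift_bounds_Suc_ivl
      by (rule sum.cong) (auto simp: detour_def nth_Cons')
    also have "\<dots> = 2 * (\<Sum>p\<leftarrow>ps. dist dep p) - tour_cost dep ps"
      using Cons False by simp
    finally show ?thesis
      using False tour_cost_append[of "[p]" ps dep]
      by (simp add: detour_def tour_cost_eq[of "[p]"] hd_conv_nth)
  qed
qed simp

lemma detour_drop:
  assumes "1 \<le> j" "i + j < length ps"
  shows "detour dep (drop i ps) j = detour dep ps (i + j)"
  using assms by (simp add: detour_def)

lemma tour_cost_split:
  assumes "1 \<le> i" "i < length ps"
  shows "tour_cost dep (take i ps) + tour_cost dep (drop i ps) = tour_cost dep ps + detour dep ps i"
proof -
  have "last (take i ps) = ps ! (i - 1)" "hd (drop i ps) = ps ! i"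
    using assms by (cases i; simp add: take_Suc_conv_app_nth hd_drop_conv_nth)+
  moreover have "ps \<noteq> []" using assms by auto
  ultimately show ?thesis
    using tour_cost_append[of "take i ps" "drop i ps" dep] assms
    by (simp add: detour_def)
qed

text \<open>Consecutive chunks meet exactly at the multiples of \<open>k\<close>, and each cut there
  adds one detour.\<close>

lemma sum_chunks:
  assumes "1 \<le> k"
  shows "(\<Sum>c\<leftarrow>chunks k ps. tour_cost dep c)
       = tour_cost dep ps + (\<Sum>j\<in>{j\<in>{1..<length ps}. j mod k = 0}. detour dep ps j)"
proof (induction "length ps" arbitrary: ps rule: less_induct)
  case less
  show ?case
  proof (cases "k < length ps")
    case False
    have "{j\<in>{1..<length ps}. j mod k = 0} = {}"
      using False by (auto simp: mod_eq_0_iff_dvd dest!: dvd_imp_le)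
    moreover have "(\<Sum>c\<leftarrow>chunks k ps. tour_cost dep c) = tour_cost dep ps"
      using False assms by (cases "ps = []") (simp_all add: chunks.simps[of k])
    ultimately show ?thesis by (simp only: sum.empty add_0_right)
  next
    case True
    have "(\<Sum>c\<leftarrow>chunks k ps. tour_cost dep c)
        = tour_cost dep (take k ps) + (\<Sum>c\<leftarrow>chunks k (drop k ps). tour_cost dep c)"
      using True assms by (subst chunks.simps) auto
    also have "(\<Sum>c\<leftarrow>chunks k (drop k ps). tour_cost dep c)
        = tour_cost dep (drop k ps)
          + (\<Sum>j\<in>{j\<in>{1..<length (drop k ps)}. j mod k = 0}. detour dep (drop k ps) j)"
      by (rule less) (use True assms in auto)
    \<comment> \<open>Positions in the remainder are shifted by \<open>k\<close>, so only the cut at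
      \<open>k\<close> itself is missing; it comes from \<open>tour_cost_split\<close>.\<close>
    also have "(\<Sum>j\<in>{j\<in>{1..<length (drop k ps)}. j mod k = 0}. detour dep (drop k ps) j)
        = (\<Sum>j\<in>{j\<in>{1..<length ps}. j mod k = 0} - {k}. detour dep ps j)"
    proof (rule sum.reindex_bij_witness[of _ "\<lambda>j. j - k" "\<lambda>j. k + j"], goal_cases)
      case (4 j)
      then have "k \<le> j" using assms by (auto simp: mod_eq_0_iff_dvd dest!: dvd_imp_le)
      then show ?case using 4 by (auto simp: le_mod_geq[symmetric])
    next
      case (5 j)
      then show ?case by (auto simp: detour_drop)
    qed (use assms in \<open>auto simp: mod_eq_0_iff_dvd dest!: dvd_imp_le\<close>)
    also have "(\<Sum>j\<in>{j\<in>{1..<length ps}. j mod k = 0}. detour dep ps j)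
        = detour dep ps k + (\<Sum>j\<in>{j\<in>{1..<length ps}. j mod k = 0} - {k}. detour dep ps j)"
      by (rule sum.remove) (use True assms in auto)
    ultimately show ?thesis
      using tour_cost_split[of k ps dep] True assms by simp
  qed
qed

text \<open>The cuts of the partition are at \<open>i\<close>, \<open>i + k\<close>,
  \<open>i + 2 * k\<close>, ..., which is a full residue class modulo \<open>k\<close> within the
  tour.\<close>

lemma itp_part_cost_eq:
  assumes "1 \<le> i" "i \<le> k" "ps \<noteq> []"
  shows "itp_part_cost dep k ps i
       = tour_cost dep ps + (\<Sum>j\<in>{j\<in>{1..<length ps}. j mod k = i mod k}. detour dep ps j)"
proof (cases "i < length ps")
  case False
  then have "{j\<in>{1..<length ps}. j mod k = i mod k} = {}"
    using assms by (cases "i = k") (auto simp: mod_eq_0_iff_dvd dest!: dvd_imp_le)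
  moreover have "itp_part_cost dep k ps i = tour_cost dep ps"
    using False by (simp add: itp_part_cost_def chunks.simps)
  ultimately show ?thesis by (simp only: sum.empty add_0_right)
next
  case True
  \<comment> \<open>As 1 \<le> \<open>i\<close> \<le> \<open>k\<close>, the least positive number in
    its residue class is \<open>i\<close>, also for \<open>i = k\<close> with residue 0.\<close>
  have ge: "i \<le> j" if "j \<in> {1..<length ps}" "j mod k = i mod k" for j
  proof (cases "i = k")
    case True
    then show ?thesis using that by (auto simp: mod_eq_0_iff_dvd dest!: dvd_imp_le)
  next
    case False
    then have "j mod k = i" using that assms by simp
    then show ?thesis using mod_less_eq_dividend by metis
  qed
  have "(\<Sum>j\<in>{j\<in>{1..<length (drop i ps)}. j mod k = 0}. detour dep (drop i ps) j)
      = (\<Sum>j\<in>{j\<in>{1..<length ps}. j mod k = i mod k} - {i}. detour dep ps j)"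
  proof (rule sum.reindex_bij_witness[of _ "\<lambda>j. j - i" "\<lambda>j. i + j"], goal_cases)
    case (3 j)
    then show ?case using ge[of j] by auto
  next
    case (4 j)
    then show ?case using ge[of j] by (auto simp: mod_eq_dvd_iff_nat)
  next
    case (5 j)
    then show ?case by (auto simp: detour_drop)
  qed (auto simp: mod_add_right_eq[symmetric])
  moreover have "(\<Sum>j\<in>{j\<in>{1..<length ps}. j mod k = i mod k}. detour dep ps j)
      = detour dep ps i + (\<Sum>j\<in>{j\<in>{1..<length ps}. j mod k = i mod k} - {i}. detour dep ps j)"
    by (rule sum.remove) (use True assms in auto)
  ultimately show ?thesis
    using tour_cost_split[of i ps dep] True assms sum_chunks[of k dep "drop i ps"]
    by (simp add: itp_part_cost_def)
qed

text \<open>The \<open>k\<close> residue classes partition the positions, so over all partitions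
  each detour is paid exactly once.\<close>

lemma sum_itp_part_cost:
  assumes "1 \<le> k" "ps \<noteq> []"
  shows "(\<Sum>i\<in>{1..k}. itp_part_cost dep k ps i)
       = (real k - 1) * tour_cost dep ps + 2 * (\<Sum>p\<leftarrow>ps. dist dep p)"
proof -
  let ?A = "{1..<length ps}"
  have "(\<Sum>i\<in>{1..k}. \<Sum>j\<in>{j\<in>?A. j mod k = i mod k}. detour dep ps j)
      = (\<Sum>r\<in>{..<k}. \<Sum>j\<in>{j\<in>?A. j mod k = r}. detour dep ps j)"
    by (rule sum.reindex_bij_witness[of _ "\<lambda>r. if r = 0 then k else r" "\<lambda>i. i mod k"])
       (use assms in \<open>auto simp: mod_if\<close>)
  also have "\<dots> = (\<Sum>j\<in>?A. detour dep ps j)"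
    using assms by (intro sum.group) auto
  finally have "(\<Sum>i\<in>{1..k}. itp_part_cost dep k ps i)
      = real k * tour_cost dep ps + (\<Sum>j\<in>?A. detour dep ps j)"
    using assms by (simp add: itp_part_cost_eq sum.distrib)
  then show ?thesis
    unfolding sum_detour[OF assms(2)] by (simp add: algebra_simps)
qed

text \<open>The minimum is at most the average; the factor (k - 1) / k of the tour cost is rounded
  up to 1.\<close>

lemma ITP_le:
  assumes "1 \<le> k" "ps \<noteq> []"
  shows "ITP dep k ps \<le> tour_cost dep ps + 2 / k * (\<Sum>p\<leftarrow>ps. dist dep p)"
proof -
  have "real k * ITP dep k ps = (\<Sum>i\<in>{1..k}. ITP dep k ps)" by simp
  also have "\<dots> \<le> (\<Sum>i\<in>{1..k}. itp_part_cost dep k ps i)"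
    unfolding ITP_def by (intro sum_mono Min_le) auto
  also have "\<dots> \<le> real k * tour_cost dep ps + 2 * (\<Sum>p\<leftarrow>ps. dist dep p)"
    unfolding sum_itp_part_cost[OF assms]
    using tour_cost_nonneg[of dep ps] by (simp add: algebra_simps)
  finally show ?thesis using assms by (simp add: field_simps)
qed

section \<open>A lower bound on the cost of a family of tours\<close>

text \<open>Solutions in \<open>cvrp_opt\<close> may visit customers repeatedly and contain empty
  tours. Counting edges and customers needs disjoint nonempty tours, obtained by shortcuts.\<close>

lemma exists_partition_tours:
  fixes tours :: "nat list list"
  assumes "\<forall>t\<in>set tours. length t \<le> k"
  shows "\<exists>ts. (\<forall>t\<in>set ts. length t \<le> k \<and> t \<noteq> []) \<and> distinct (concat ts)
            \<and> set (concat ts) = (\<Union>t\<in>set tours. set t)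
            \<and> (\<Sum>t\<leftarrow>ts. tour_cost dep (map x t)) \<le> (\<Sum>t\<leftarrow>tours. tour_cost dep (map x t))"
  using assms
proof (induction tours)
  case (Cons t tours)
  then obtain ts where ts: "\<forall>t\<in>set ts. length t \<le> k \<and> t \<noteq> []" "distinct (concat ts)"
      "set (concat ts) = (\<Union>t\<in>set tours. set t)"
      "(\<Sum>t\<leftarrow>ts. tour_cost dep (map x t)) \<le> (\<Sum>t\<leftarrow>tours. tour_cost dep (map x t))"
    by auto
  \<comment> \<open>A customer stays with the last tour that visits it; a tour left without
    customers is dropped.\<close>
  define t' where "t' = remdups (filter (\<lambda>i. i \<notin> set (concat ts)) t)"
  have t': "distinct t'" "set t' = set t - set (concat ts)" by (auto simp: t'_def)
  have cost: "tour_cost dep (map x t') \<le> tour_cost dep (map x t)"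
    unfolding t'_def using tour_cost_remdups_le tour_cost_filter_le order_trans by blast
  have len: "length t' \<le> k"
    using Cons.prems length_remdups_leq length_filter_le order_trans
    unfolding t'_def by (metis list.set_intros(1))
  show ?case
  proof (cases "t' = []")
    case True
    then have "set t \<subseteq> set (concat ts)" using t'(2) by auto
    then show ?thesis
      using ts tour_cost_nonneg[of dep "map x t"] by (intro exI[of _ ts]) auto
  next
    case False
    have "distinct (concat (t' # ts))"
      using t' ts(2) unfolding concat.simps distinct_append by blast
    moreover have "set (concat (t' # ts)) = (\<Union>t\<in>set (t # tours). set t)"
      unfolding concat.simps set_append t'(2) ts(3) by auto
    ultimately show ?thesis
      using ts(1,4) cost len False by (intro exI[of _ "t' # ts"]) auto
  qed
qed (intro exI[of _ "[]"], simp)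

lemma tsp_opt_le:
  assumes "is_ordering n \<sigma>"
  shows "tsp_opt dep x n \<le> tour_cost dep (map x \<sigma>)"
proof -
  have "{\<sigma>. is_ordering n \<sigma>} \<subseteq> {\<sigma>. set \<sigma> \<subseteq> {..<n} \<and> length \<sigma> \<le> n}"
    using distinct_card by (fastforce simp: is_ordering_def)
  then have "finite {\<sigma>. is_ordering n \<sigma>}"
    using finite_lists_length_le[of "{..<n}" n] finite_subset by blast
  then show ?thesis
    using assms unfolding tsp_opt_def by (intro Min_le) auto
qed

text \<open>Joining the tours and skipping the depot between them gives a travelling salesman
  tour.\<close>

lemma tsp_opt_le_tours:
  assumes "distinct (concat ts)" "set (concat ts) = {..<n}"
  shows "tsp_opt dep x n \<le> (\<Sum>t\<leftarrow>ts. tour_cost dep (map x t))"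
proof -
  have "tsp_opt dep x n \<le> tour_cost dep (map x (concat ts))"
    using assms by (intro tsp_opt_le) (simp add: is_ordering_def)
  also have "\<dots> \<le> (\<Sum>t\<leftarrow>ts. tour_cost dep (map x t))"
    using tour_cost_concat_le[of dep "map (map x) ts"] by (simp add: map_concat comp_def)
  finally show ?thesis .
qed

section \<open>Long and short edges between customers\<close>

fun long_edges :: "real \<Rightarrow> point list \<Rightarrow> nat" where
  "long_edges r (p # q # ps) = (if r \<le> dist p q then 1 else 0) + long_edges r (q # ps)"
| "long_edges r _ = 0"

fun short_edges :: "real \<Rightarrow> point list \<Rightarrow> nat" where
  "short_edges r (p # q # ps) = (if dist p q < r then 1 else 0) + short_edges r (q # ps)"
| "short_edges r _ = 0"

text \<open>The list holds customers only, so the two depot edges are not counted.\<close>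

lemma long_plus_short_edges:
  "ps \<noteq> [] \<Longrightarrow> real (long_edges r ps) + real (short_edges r ps) = real (length ps) - 1"
  by (induction ps rule: walk_len.induct) auto

lemma long_edges_snoc:
  "ps \<noteq> [] \<Longrightarrow> long_edges r (ps @ [q]) = long_edges r ps + (if r \<le> dist (last ps) q then 1 else 0)"
  by (induction ps rule: walk_len.induct) auto

lemma long_edges_ends:
  assumes "ps \<noteq> []"
  shows "long_edges r ps \<le> long_edges r (p # ps @ [q])"
        "long_edges r (p # ps @ [q]) \<le> long_edges r ps + 2"
proof -
  have "long_edges r (p # ps @ [q]) = (if r \<le> dist p (hd ps) then 1 else 0) + long_edges r (ps @ [q])"
    using assms by (cases ps) auto
  then show "long_edges r ps \<le> long_edges r (p # ps @ [q])"
        "long_edges r (p # ps @ [q]) \<le> long_edges r ps + 2"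
    using assms by (auto simp: long_edges_snoc)
qed

text \<open>An edge of length at least \<open>s\<close> is counted in both terms, with total weight
  r + (s - r) = s; one of length between \<open>r\<close> and \<open>s\<close> is counted with
  weight \<open>r\<close>.\<close>

lemma walk_len_ge_long_edges:
  assumes "0 \<le> r" "r \<le> s"
  shows "r * long_edges r ps + (s - r) * long_edges s ps \<le> walk_len ps"
proof (induction ps rule: walk_len.induct)
  case (1 p q ps)
  let ?r = "if r \<le> dist p q then 1 else 0 :: real" and ?s = "if s \<le> dist p q then 1 else 0 :: real"
  have "r * long_edges r (p # q # ps) + (s - r) * long_edges s (p # q # ps)
      = (r * ?r + (s - r) * ?s) + (r * long_edges r (q # ps) + (s - r) * long_edges s (q # ps))"
    by (simp add: algebra_simps)
  also have "\<dots> \<le> dist p q + walk_len (q # ps)"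
    using assms by (intro add_mono 1) auto
  finally show ?case by simp
qed auto

text \<open>Stripping two end points loses at most two long edges. The loss in the quadratic term is
  linear in \<open>g\<close>, so that twice the walk length can pay for it.\<close>

lemma square_step_le:
  fixes g g' :: nat
  assumes "g' \<le> g" "g \<le> g' + 2"
  shows "(real g)\<^sup>2 / 2 \<le> (real g')\<^sup>2 / 2 + 2 * real g"
proof -
  have "(real g - real g') * (real g + real g') \<le> 2 * (real g + real g')"
    using assms by (intro mult_right_mono) auto
  also have "\<dots> \<le> 4 * real g" using assms by simp
  finally show ?thesis by (simp add: power2_eq_square algebra_simps)
qed

text \<open>The induction strips both end points p and q of the tour. Its cost is
  |Op| + |Oq| plus the length of the walk between them, which pays for p and q, and every long
  edge of the remaining tour is counted once more, which makes the bound quadratic.\<close>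
lemma tour_cost_lower_bound:
  assumes r: "0 \<le> r" "r \<le> s"
  shows "2 * (\<Sum>p\<leftarrow>ps. dist dep p) + r * (real (long_edges r ps))\<^sup>2 / 2
           + (s - r) * (real (long_edges s ps))\<^sup>2 / 2 \<le> real (length ps) * tour_cost dep ps"
proof (induction "length ps" arbitrary: ps rule: less_induct)
  case less
  consider "ps = []" | p where "ps = [p]" | p q mid where "ps = p # mid @ [q]"
    by (metis append_butlast_last_id list.exhaust)
  then show ?case
  proof cases
    case 2
    then show ?thesis by (simp add: tour_cost_eq)
  next
    case 3
    let ?f = "\<lambda>ps. r * (real (long_edges r ps))\<^sup>2 / 2 + (s - r) * (real (long_edges s ps))\<^sup>2 / 2"
    let ?W = "walk_len ps" and ?D = "\<lambda>ps. \<Sum>p\<leftarrow>ps. dist dep p"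
    have c: "tour_cost dep ps = dist dep p + dist dep q + ?W"
      by (simp add: 3 tour_cost_eq)
    \<comment> \<open>Of the \<open>length ps\<close> copies of the tour cost, two pay for
      \<open>p\<close>, \<open>q\<close> and the growth of \<open>?f\<close>, since each contains
      \<open>?W\<close>. The others cover \<open>mid\<close>, whose tour is no longer than that of
      \<open>ps\<close>.\<close>
    have mid: "?f ps \<le> ?f mid + 2 * ?W \<and> 2 * ?D mid + ?f mid \<le> real (length mid) * tour_cost dep ps"
    proof (cases "mid = []")
      case True
      have sq: "(real g)\<^sup>2 / 2 \<le> 2 * real g" if "g \<le> 1" for g :: nat
        using that by (cases g) auto
      have "?f ps \<le> r * (2 * real (long_edges r ps)) + (s - r) * (2 * real (long_edges s ps))"
        unfolding times_divide_eq_right[symmetric] using True 3 r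
        by (intro add_mono mult_left_mono sq) auto
      also have "\<dots> \<le> 2 * ?W" using walk_len_ge_long_edges[OF r, of ps] by (simp add: algebra_simps)
      finally show ?thesis using True by simp
    next
      case False
      have "?f ps \<le> r * ((real (long_edges r mid))\<^sup>2 / 2 + 2 * real (long_edges r ps))
                + (s - r) * ((real (long_edges s mid))\<^sup>2 / 2 + 2 * real (long_edges s ps))"
        unfolding times_divide_eq_right[symmetric] using r long_edges_ends[OF False]
        by (intro add_mono mult_left_mono square_step_le) (auto simp: 3)
      also have "\<dots> \<le> ?f mid + 2 * ?W"
        using walk_len_ge_long_edges[OF r, of ps] by (simp add: algebra_simps)
      finally have 1: "?f ps \<le> ?f mid + 2 * ?W" .
      have "walk_len ps = dist p (hd mid) + walk_len mid + dist (last mid) q"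
        using False walk_len_append[of "p # mid" "[q]"] walk_len_append[of "[p]" mid] by (simp add: 3)
      then have "tour_cost dep mid \<le> tour_cost dep ps"
        using False dist_triangle[of dep "hd mid" p] dist_triangle[of dep "last mid" q]
        by (simp add: c tour_cost_eq dist_commute)
      then have "real (length mid) * tour_cost dep mid \<le> real (length mid) * tour_cost dep ps"
        by (intro mult_left_mono) auto
      with less[of mid] have "2 * ?D mid + ?f mid \<le> real (length mid) * tour_cost dep ps"
        by (simp add: 3)
      with 1 show ?thesis by blast
    qed
    have "?D ps = dist dep p + dist dep q + ?D mid" by (simp add: 3)
    moreover have "real (length ps) * tour_cost dep ps
        = 2 * tour_cost dep ps + real (length mid) * tour_cost dep ps"
      by (simp add: 3 algebra_simps)
    ultimately show ?thesis using conjunct1[OF mid] conjunct2[OF mid] c by linarith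
  qed simp
qed

text \<open>The tangent to g^2 / (2 m) at g = l m, with slope \<open>l\<close>. It is linear in
  \<open>g\<close> and \<open>m\<close> jointly.\<close>

lemma square_tangent:
  fixes g m l :: real
  assumes "0 < m"
  shows "l * g - l\<^sup>2 * m / 2 \<le> g\<^sup>2 / 2 / m"
proof -
  have "0 \<le> (g - l * m)\<^sup>2" by simp
  then show ?thesis using assms by (simp add: field_simps power2_eq_square)
qed

text \<open>Dividing the quadratic bound by the number of customers turns the radial term into 2 /
  m, which is at least 2 / k. The slopes \<open>l\<close> and \<open>l'\<close> do not depend on the
  tour, so these bounds can be summed.\<close>

lemma tour_cost_lower_bound_linear:
  fixes l l' :: real
  assumes r: "0 \<le> r" "r \<le> s" and ps: "ps \<noteq> []" "length ps \<le> k"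
  shows "2 / k * (\<Sum>p\<leftarrow>ps. dist dep p)
           + r * (l * long_edges r ps - l\<^sup>2 * length ps / 2)
           + (s - r) * (l' * long_edges s ps - l'\<^sup>2 * length ps / 2) \<le> tour_cost dep ps"
proof -
  let ?m = "real (length ps)" and ?D = "\<Sum>p\<leftarrow>ps. dist dep p"
  have m: "0 < ?m" "?m \<le> real k" using ps by auto
  have D: "0 \<le> ?D" by (intro sum_list_nonneg) auto
  have "2 / k * ?D \<le> 2 * ?D / ?m"
    using m D frac_le[of "2 * ?D" "2 * ?D" ?m "real k"] by simp
  moreover have "r * (l * long_edges r ps - l\<^sup>2 * length ps / 2) \<le> r * ((long_edges r ps)\<^sup>2 / 2 / ?m)"
    using square_tangent[OF m(1), of l] r by (intro mult_left_mono) auto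
  moreover have "(s - r) * (l' * long_edges s ps - l'\<^sup>2 * length ps / 2)
      \<le> (s - r) * ((long_edges s ps)\<^sup>2 / 2 / ?m)"
    using square_tangent[OF m(1), of l'] r by (intro mult_left_mono) auto
  moreover have "2 * ?D / ?m + r * ((long_edges r ps)\<^sup>2 / 2 / ?m) + (s - r) * ((long_edges s ps)\<^sup>2 / 2 / ?m)
      \<le> tour_cost dep ps"
  proof -
    have "(2 * ?D + r * (long_edges r ps)\<^sup>2 / 2 + (s - r) * (long_edges s ps)\<^sup>2 / 2) / ?m
        \<le> tour_cost dep ps"
      using tour_cost_lower_bound[OF r, of dep ps] m(1) by (simp add: pos_divide_le_eq mult.commute)
    then show ?thesis by (simp add: add_divide_distrib)
  qed
  ultimately show ?thesis by linarith
qed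

text \<open>This count depends on the points alone, so one probability estimate controls the short
  edges of all solutions at once, including an optimal one.\<close>

definition close_pairs :: "(nat \<Rightarrow> point) \<Rightarrow> real \<Rightarrow> nat set \<Rightarrow> (nat \<times> nat) set" where
  "close_pairs x r A = {(i, j). i \<in> A \<and> j \<in> A \<and> i < j \<and> dist (x i) (x j) < r}"

lemma finite_close_pairs: "finite A \<Longrightarrow> finite (close_pairs x r A)"
  by (rule finite_subset[of _ "A \<times> A"]) (auto simp: close_pairs_def)

lemma short_edges_le:
  assumes "distinct t"
  shows "short_edges r (map x t) \<le> card (close_pairs x r (set t))"
  using assms
proof (induction t rule: induct_list012)
  case (3 i j t)
  let ?C = "close_pairs x r (set (j # t))" and ?C' = "close_pairs x r (set (i # j # t))"
  have fin: "finite ?C'" by (intro finite_close_pairs) auto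
  have sub: "?C \<subseteq> ?C'" by (auto simp: close_pairs_def)
  show ?case
  proof (cases "dist (x i) (x j) < r")
    case True
    \<comment> \<open>The new pair contains \<open>i\<close>, which by distinctness does not occur
      in the rest of the tour.\<close>
    have "insert (min i j, max i j) ?C \<subseteq> ?C'" "(min i j, max i j) \<notin> ?C"
      using 3 True by (auto simp: close_pairs_def min_def max_def dist_commute)
    then have "Suc (card ?C) \<le> card ?C'"
      using fin finite_subset[OF sub] by (metis card_insert_disjoint card_mono)
    then show ?thesis using 3 True by simp
  next
    case False
    then show ?thesis using 3 card_mono[OF fin sub] by simp
  qed
qed auto

lemma short_edges_append: "short_edges r ps + short_edges r qs \<le> short_edges r (ps @ qs)"
proof (induction ps rule: walk_len.induct)
  case ("2_2" p)
  then show ?case by (cases qs) auto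
qed auto

lemma sum_short_edges_le:
  assumes "distinct (concat ts)"
  shows "(\<Sum>t\<leftarrow>ts. short_edges r (map x t)) \<le> card (close_pairs x r (set (concat ts)))"
proof -
  have "(\<Sum>t\<leftarrow>ts. short_edges r (map x t)) \<le> short_edges r (map x (concat ts))"
  proof (induction ts)
    case (Cons t ts)
    then show ?case using short_edges_append[of r "map x t" "map x (concat ts)"] by simp
  qed simp
  then show ?thesis using short_edges_le[OF assms] order_trans by blast
qed

text \<open>The tours have n - \<open>length ts\<close> edges between customers, and distinct short
  edges are distinct close pairs.\<close>

lemma sum_long_edges_ge:
  assumes "distinct (concat ts)" "set (concat ts) = {..<n}" "[] \<notin> set ts"
  shows "real n - real (length ts) - card (close_pairs x r {..<n})
       \<le> (\<Sum>t\<leftarrow>ts. real (long_edges r (map x t)))"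
proof -
  have "(\<Sum>t\<leftarrow>ts. real (long_edges r (map x t)))
      = (\<Sum>t\<leftarrow>ts. (real (length t) - 1) - real (short_edges r (map x t)))"
  proof (intro arg_cong[of _ _ sum_list] map_cong refl)
    fix t assume "t \<in> set ts"
    then have "map x t \<noteq> []" using assms(3) by auto
    from long_plus_short_edges[OF this, of r]
    show "real (long_edges r (map x t)) = (real (length t) - 1) - real (short_edges r (map x t))"
      by simp
  qed
  also have "\<dots> = real (length (concat ts)) - real (length ts) - real (\<Sum>t\<leftarrow>ts. short_edges r (map x t))"
    by (induction ts) auto
  also have "length (concat ts) = n"
    using assms distinct_card by fastforce
  finally show ?thesis
    using sum_short_edges_le[OF assms(1), of r x] unfolding assms(2) by simp
qed

lemma sum_list_concat_distinct:
  assumes "distinct (concat ts)" "set (concat ts) = {..<n}"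
  shows "(\<Sum>t\<leftarrow>ts. \<Sum>i\<leftarrow>t. f i) = (\<Sum>i<n. f i :: real)"
proof -
  have "(\<Sum>t\<leftarrow>ts. \<Sum>i\<leftarrow>t. f i) = (\<Sum>i\<leftarrow>concat ts. f i)"
    by (induction ts) auto
  also have "\<dots> = (\<Sum>i<n. f i)"
    using assms by (simp only: sum_list_distinct_conv_sum_set)
  finally show ?thesis .
qed

text \<open>After summation the gain over the radial term depends on the tours only through their
  number.\<close>

lemma tours_lower_bound:
  assumes r: "0 \<le> r" "r \<le> s" and l: "0 \<le> l" "0 \<le> l'"
    and ts: "distinct (concat ts)" "set (concat ts) = {..<n}" "\<forall>t\<in>set ts. length t \<le> k \<and> t \<noteq> []"
  shows "2 / k * (\<Sum>i<n. dist dep (x i))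
      + r * (l * (real n - length ts - card (close_pairs x r {..<n})) - l\<^sup>2 * n / 2)
      + (s - r) * (l' * (real n - length ts - card (close_pairs x s {..<n})) - l'\<^sup>2 * n / 2)
      \<le> (\<Sum>t\<leftarrow>ts. tour_cost dep (map x t))"
proof -
  let ?L = "\<lambda>r. \<Sum>t\<leftarrow>ts. real (long_edges r (map x t))"
  have "[] \<notin> set ts" using ts(3) by auto
  note L = sum_long_edges_ge[OF ts(1,2) this, of x]
  have n: "real (length (concat ts)) = n"
    using ts distinct_card by fastforce
  have "2 / k * (\<Sum>t\<leftarrow>ts. \<Sum>i\<leftarrow>t. dist dep (x i))
      + r * (l * ?L r - l\<^sup>2 * real (length (concat ts)) / 2)
      + (s - r) * (l' * ?L s - l'\<^sup>2 * real (length (concat ts)) / 2)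
      = (\<Sum>t\<leftarrow>ts. 2 / k * (\<Sum>p\<leftarrow>map x t. dist dep p)
           + r * (l * long_edges r (map x t) - l\<^sup>2 * length (map x t) / 2)
           + (s - r) * (l' * long_edges s (map x t) - l'\<^sup>2 * length (map x t) / 2))"
    by (induction ts) (auto simp: algebra_simps comp_def add_divide_distrib)
  also have "\<dots> \<le> (\<Sum>t\<leftarrow>ts. tour_cost dep (map x t))"
  proof (rule sum_list_mono)
    fix t assume "t \<in> set ts"
    then have "map x t \<noteq> []" "length (map x t) \<le> k" using ts(3) by auto
    from tour_cost_lower_bound_linear[OF r this, of dep l l']
    show "2 / k * (\<Sum>p\<leftarrow>map x t. dist dep p)
           + r * (l * long_edges r (map x t) - l\<^sup>2 * length (map x t) / 2)
           + (s - r) * (l' * long_edges s (map x t) - l'\<^sup>2 * length (map x t) / 2)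
        \<le> tour_cost dep (map x t)" .
  qed
  finally have "2 / k * (\<Sum>i<n. dist dep (x i)) + r * (l * ?L r - l\<^sup>2 * n / 2)
      + (s - r) * (l' * ?L s - l'\<^sup>2 * n / 2) \<le> (\<Sum>t\<leftarrow>ts. tour_cost dep (map x t))"
    unfolding n sum_list_concat_distinct[OF ts(1,2)] .
  moreover have "r * (l * (real n - length ts - card (close_pairs x r {..<n})) - l\<^sup>2 * n / 2)
      \<le> r * (l * ?L r - l\<^sup>2 * n / 2)"
    using r l L by (intro mult_left_mono diff_right_mono) auto
  moreover have "(s - r) * (l' * (real n - length ts - card (close_pairs x s {..<n})) - l'\<^sup>2 * n / 2)
      \<le> (s - r) * (l' * ?L s - l'\<^sup>2 * n / 2)"
    using r l L by (intro mult_left_mono diff_right_mono) auto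
  ultimately show ?thesis by linarith
qed

lemma radial_lower_bound:
  fixes ts :: "nat list list"
  assumes ts: "distinct (concat ts)" "set (concat ts) = {..<n}" "\<forall>t\<in>set ts. length t \<le> k \<and> t \<noteq> []"
  shows "2 / k * (\<Sum>i<n. dist dep (x i)) \<le> (\<Sum>t\<leftarrow>ts. tour_cost dep (map x t))"
  using tours_lower_bound[of 0 0 0 0 ts n k dep x] ts by simp

text \<open>Every tour either stays close to the depot or costs at least twice e.\<close>
lemma number_of_tours_le:
  fixes ts :: "nat list list"
  assumes e: "0 < e"
    and ts: "distinct (concat ts)" "set (concat ts) = {..<n}" "\<forall>t\<in>set ts. t \<noteq> []"
  shows "real (length ts) \<le> card {i. i < n \<and> dist dep (x i) < e}
            + (\<Sum>t\<leftarrow>ts. tour_cost dep (map x t)) / (2 * e)"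
proof -
  let ?b = "\<lambda>i. if dist dep (x i) < e then 1 else 0 :: real"
  have "real (length ts) = (\<Sum>t\<leftarrow>ts. 1)" by (simp add: sum_list_triv)
  also have "\<dots> \<le> (\<Sum>t\<leftarrow>ts. (\<Sum>i\<leftarrow>t. ?b i) + tour_cost dep (map x t) / (2 * e))"
  proof (rule sum_list_mono)
    fix t assume "t \<in> set ts"
    with ts(3) obtain i t' where t: "t = i # t'" by (metis list.exhaust)
    have b: "0 \<le> (\<Sum>i\<leftarrow>t'. ?b i)" by (intro sum_list_nonneg) auto
    show "1 \<le> (\<Sum>i\<leftarrow>t. ?b i) + tour_cost dep (map x t) / (2 * e)"
    proof (cases "dist dep (x i) < e")
      case True
      then show ?thesis using b e tour_cost_nonneg[of dep "map x t"] by (simp add: t)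
    next
      case False
      let ?p = "last (map x t)"
      have "walk_len (map x t) \<ge> dist (x i) ?p"
      proof -
        have "dist (hd ps) (last ps) \<le> walk_len ps" if "ps \<noteq> []" for ps
          using that
        proof (induction ps rule: walk_len.induct)
          case (1 p q ps)
          then show ?case using dist_triangle[of p "last (q # ps)" q] by auto
        qed auto
        from this[of "map x t"] show ?thesis by (simp add: t)
      qed
      then have "2 * e \<le> tour_cost dep (map x t)"
        using False dist_triangle[of dep "x i" ?p]
        by (simp add: tour_cost_eq t dist_commute)
      then have "1 \<le> tour_cost dep (map x t) / (2 * e)" using e by simp
      then show ?thesis using b False by (simp add: t)
    qed
  qed
  also have "\<dots> = (\<Sum>t\<leftarrow>ts. \<Sum>i\<leftarrow>t. ?b i) + (\<Sum>t\<leftarrow>ts. tour_cost dep (map x t)) / (2 * e)"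
    by (induction ts) (auto simp: add_divide_distrib)
  also have "(\<Sum>t\<leftarrow>ts. \<Sum>i\<leftarrow>t. ?b i) = (\<Sum>i<n. ?b i)"
    by (rule sum_list_concat_distinct[OF ts(1,2)])
  also have "\<dots> = (\<Sum>i\<in>{i \<in> {..<n}. dist dep (x i) < e}. 1)"
    by (rule sum.inter_filter[symmetric]) simp
  also have "\<dots> = card {i. i < n \<and> dist dep (x i) < e}" by simp
  finally show ?thesis .
qed

section \<open>An upper bound on the optimal travelling salesman tour\<close>

text \<open>The key differences telescope, and \<open>e i\<close> is paid once for each edge at
  \<open>i\<close>. The two \<open>e\<close> terms on the left account for the missing edge at
  either end.\<close>

lemma walk_len_sorted_le:
  fixes e t :: "'a \<Rightarrow> real"
  assumes "\<And>i j. i \<in> set xs \<Longrightarrow> j \<in> set xs \<Longrightarrow> t i \<le> t j \<Longrightarrow> dist (x i) (x j) \<le> e i + e j + (t j - t i)"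
    and "sorted (map t xs)" "xs \<noteq> []"
  shows "walk_len (map x xs) + e (hd xs) + e (last xs)
           \<le> 2 * (\<Sum>i\<leftarrow>xs. e i) + (t (last xs) - t (hd xs))"
  using assms
proof (induction xs rule: induct_list012)
  case (3 i j xs)
  have "walk_len (map x (j # xs)) + e (hd (j # xs)) + e (last (j # xs))
           \<le> 2 * (\<Sum>i\<leftarrow>j # xs. e i) + (t (last (j # xs)) - t (hd (j # xs)))"
    using 3 by (intro "3.IH"(2)) auto
  moreover have "dist (x i) (x j) \<le> e i + e j + (t j - t i)"
    using 3 by (intro "3.prems"(1)) auto
  ultimately show ?case by simp
qed auto

text \<open>The points lie in strips, the one of index s i being centred on the vertical line with
  abscissa c + h * s i. The key t is the arc length along the curve which runs through these lines
  alternately upwards and downwards, and e is the distance of a point from its line.\<close>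
lemma dist_le_zigzag:
  fixes x :: "'a \<Rightarrow> point" and s :: "'a \<Rightarrow> nat" and c h :: real
  assumes h: "0 < h" and sq: "\<And>i. i \<in> A \<Longrightarrow> x i \<in> {0..1} \<times> {0..1}"
  defines "e \<equiv> \<lambda>i. \<bar>fst (x i) - (c + h * s i)\<bar>"
    and "v \<equiv> \<lambda>i. if even (s i) then snd (x i) else 1 - snd (x i)"
  defines "t \<equiv> \<lambda>i. real (s i) * (1 + h) + v i"
  assumes ij: "i \<in> A" "j \<in> A" "t i \<le> t j"
  shows "dist (x i) (x j) \<le> e i + e j + (t j - t i)"
proof -
  have v01: "0 \<le> v i" "v i \<le> 1" "0 \<le> v j" "v j \<le> 1"
    using sq[OF ij(1)] sq[OF ij(2)] by (auto simp: v_def mem_Times_iff)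
  have y: "0 \<le> snd (x i)" "snd (x i) \<le> 1" "0 \<le> snd (x j)" "snd (x j) \<le> 1"
    using sq[OF ij(1)] sq[OF ij(2)] by (auto simp: mem_Times_iff)
  \<comment> \<open>A strip uses keys from an interval of length 1, and the intervals of consecutive
    strips are separated by \<open>h\<close>, the horizontal move between their lines.\<close>
  have le: "s i \<le> s j"
  proof (rule ccontr)
    assume "\<not> s i \<le> s j"
    then have "real (s j) + 1 \<le> real (s i)" by simp
    then have "(real (s j) + 1) * (1 + h) \<le> real (s i) * (1 + h)"
      using h by (intro mult_right_mono) auto
    moreover have "t j \<le> real (s j) * (1 + h) + 1" "real (s i) * (1 + h) \<le> t i"
      using v01 by (auto simp: t_def)
    ultimately show False using h ij(3) by (simp add: algebra_simps)
  qed
  \<comment> \<open>Within a strip, \<open>v\<close> is the height up to reflection. Adjacent strips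
    run in opposite directions, so the curve links their heights; for strips further apart the right
    side is at least 1.\<close>
  have "\<bar>snd (x i) - snd (x j)\<bar> \<le> (real (s j) - real (s i)) + (v j - v i)"
  proof -
    consider "s i = s j" | "s j = Suc (s i)" | "s i + 2 \<le> s j" using le by linarith
    then show ?thesis
    proof cases
      case 1
      then have "v i \<le> v j" using ij(3) by (simp add: t_def)
      then show ?thesis using 1 by (auto simp: v_def split: if_splits)
    next
      case 2
      then show ?thesis using y by (auto simp: v_def)
    next
      case 3
      then have "real (s i) + 2 \<le> real (s j)" by linarith
      then show ?thesis using y v01 by linarith
    qed
  qed
  moreover have "\<bar>fst (x i) - fst (x j)\<bar> \<le> e i + e j + h * (real (s j) - real (s i))"
  proof -
    have "h * real (s i) \<le> h * real (s j)" using le h by (intro mult_left_mono) auto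
    then show ?thesis unfolding e_def by (simp add: algebra_simps)
  qed
  moreover have "dist (x i) (x j) \<le> \<bar>fst (x i) - fst (x j)\<bar> + \<bar>snd (x i) - snd (x j)\<bar>"
    by (simp add: dist_prod_def dist_real_def sqrt_sum_squares_le_sum_abs)
  ultimately show ?thesis by (simp add: t_def algebra_simps)
qed

text \<open>The points are visited in the order of their keys. \<open>2 * D\<close> pays the depot
  edges, \<open>real m * (1 + h) + 1\<close> the curve through \<open>m + 1\<close> strips, and each
  point is reached from its line and left again.\<close>

lemma tsp_opt_le_strips:
  fixes x :: "nat \<Rightarrow> point" and s :: "nat \<Rightarrow> nat" and c h :: real
  assumes n: "1 \<le> n" and h: "0 < h" and sq: "\<And>i. i < n \<Longrightarrow> x i \<in> {0..1} \<times> {0..1}"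
    and s: "\<And>i. i < n \<Longrightarrow> s i \<le> m"
    and D: "\<And>i. i < n \<Longrightarrow> dist dep (x i) \<le> D"
  shows "tsp_opt dep x n \<le> 2 * D + real m * (1 + h) + 1 + 2 * (\<Sum>i<n. \<bar>fst (x i) - (c + h * s i)\<bar>)"
proof -
  define e where "e = (\<lambda>i. \<bar>fst (x i) - (c + h * s i)\<bar>)"
  define v where "v = (\<lambda>i. if even (s i) then snd (x i) else 1 - snd (x i))"
  define t where "t = (\<lambda>i. real (s i) * (1 + h) + v i)"
  define xs where "xs = sort_key t [0..<n]"
  have xs: "distinct xs" "set xs = {..<n}" "sorted (map t xs)" "xs \<noteq> []"
    using n by (auto simp: xs_def simp flip: set_empty)
  have first_last: "hd xs < n" "last xs < n"
    using xs hd_in_set[of xs] last_in_set[of xs] by auto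
  have "walk_len (map x xs) + e (hd xs) + e (last xs)
      \<le> 2 * (\<Sum>i\<leftarrow>xs. e i) + (t (last xs) - t (hd xs))"
  proof (rule walk_len_sorted_le)
    fix i j assume "i \<in> set xs" "j \<in> set xs" "t i \<le> t j"
    then show "dist (x i) (x j) \<le> e i + e j + (t j - t i)"
      using dist_le_zigzag[of h "{..<n}" x i j s c] h sq
      unfolding xs(2) e_def t_def v_def by auto
  qed (use xs in auto)
  moreover have "(\<Sum>i\<leftarrow>xs. e i) = (\<Sum>i<n. e i)"
    using xs by (simp only: sum_list_distinct_conv_sum_set)
  moreover have v: "0 \<le> v i" "v i \<le> 1" if "i < n" for i
    using sq[OF that] by (auto simp: v_def mem_Times_iff)
  have "0 \<le> t (hd xs)" using v[OF first_last(1)] h by (simp add: t_def)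
  moreover have "t (last xs) \<le> real m * (1 + h) + 1"
    unfolding t_def using v[OF first_last(2)] h s[OF first_last(2)]
    by (intro add_mono mult_right_mono) auto
  moreover have "0 \<le> e (hd xs)" "0 \<le> e (last xs)" by (auto simp: e_def)
  moreover have "tour_cost dep (map x xs) = dist dep (x (hd xs)) + walk_len (map x xs) + dist dep (x (last xs))"
    using xs(4) by (simp add: tour_cost_eq hd_map last_map)
  moreover have "tsp_opt dep x n \<le> tour_cost dep (map x xs)"
    using xs by (intro tsp_opt_le) (simp add: is_ordering_def)
  ultimately show ?thesis
    using D[OF first_last(1)] D[OF first_last(2)] unfolding e_def by linarith
qed

text \<open>Few's argument: of two systems of strips of width h, shifted against each other by h / 2,
  one has centre lines at average distance at most h / 4 from the points.\<close>
lemma shifted_strips: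
  fixes u h :: real
  assumes "0 < h" "0 \<le> u"
  shows "\<bar>u - h * real (nat \<lfloor>u / h + 1 / 2\<rfloor>)\<bar> + \<bar>u - (h / 2 + h * real (nat \<lfloor>u / h\<rfloor>))\<bar> = h / 2"
proof -
  \<comment> \<open>The two distances are h min(f, 1 - f) and h |f - 1/2|, which always add up to h
    / 2.\<close>
  define f where "f = frac (u / h)"
  have f: "0 \<le> f" "f < 1" "u / h = real_of_int \<lfloor>u / h\<rfloor> + f"
    using frac_lt_1[of "u / h"] frac_ge_0[of "u / h"] by (simp_all add: f_def) (simp add: frac_def)
  have q: "0 \<le> u / h" using assms by simp
  have 0: "real (nat \<lfloor>u / h\<rfloor>) = u / h - f" using q f(3) by simp
  have "\<lfloor>u / h + 1 / 2\<rfloor> = (if f < 1 / 2 then \<lfloor>u / h\<rfloor> else \<lfloor>u / h\<rfloor> + 1)"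
    using f by (auto simp: floor_eq_iff)
  then have 1: "real (nat \<lfloor>u / h + 1 / 2\<rfloor>) = (if f < 1 / 2 then u / h - f else u / h - f + 1)"
    using q f(3) by auto
  have "u - h * (u / h - f) = h * f" "u - (h / 2 + h * (u / h - f)) = h * (f - 1 / 2)"
       "u - h * (u / h - f + 1) = h * (f - 1)"
    using assms by (auto simp: field_simps)
  note eqs = this
  show ?thesis
  proof (cases "f < 1 / 2")
    case True
    have "\<bar>u - h * real (nat \<lfloor>u / h + 1 / 2\<rfloor>)\<bar> = h * f"
      unfolding 1 using True assms f by (simp only: if_True eqs) (simp add: abs_mult)
    moreover have "\<bar>u - (h / 2 + h * real (nat \<lfloor>u / h\<rfloor>))\<bar> = h * (1 / 2 - f)"
      unfolding 0 eqs using True assms by (simp add: abs_mult)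
    ultimately show ?thesis by (simp add: algebra_simps)
  next
    case False
    have "\<bar>u - h * real (nat \<lfloor>u / h + 1 / 2\<rfloor>)\<bar> = h * (1 - f)"
      unfolding 1 using False assms f by (simp only: if_False eqs) (simp add: abs_mult)
    moreover have "\<bar>u - (h / 2 + h * real (nat \<lfloor>u / h\<rfloor>))\<bar> = h * (f - 1 / 2)"
      unfolding 0 eqs using False assms by (simp add: abs_mult)
    ultimately show ?thesis by (simp add: algebra_simps)
  qed
qed

lemma tsp_opt_le_sqrt:
  assumes n: "1 \<le> n" and sq: "\<And>i. i < n \<Longrightarrow> x i \<in> {0..1} \<times> {0..1}"
    and D: "\<And>i. i < n \<Longrightarrow> dist dep (x i) \<le> D"
  shows "tsp_opt dep x n \<le> sqrt 2 * sqrt n + (2 * D + 3)"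
proof -
  \<comment> \<open>Averaging the two strip systems leaves m + n / (2 m) up to a constant, which is
    smallest at m = sqrt (n / 2) with value sqrt (2 n).\<close>
  define m where "m = nat \<lceil>sqrt (n / 2)\<rceil>"
  define h where "h = 1 / real m"
  have "0 < sqrt (real n / 2)" using n by simp
  then have m: "sqrt (n / 2) \<le> m" "m \<le> sqrt (n / 2) + 1" "1 \<le> m"
    unfolding m_def by linarith+
  have h: "0 < h" "real m * h = 1" using m by (auto simp: h_def)
  have u: "0 \<le> fst (x i)" "fst (x i) / h \<le> m" if "i < n" for i
    using sq[OF that] m by (auto simp: h_def mem_Times_iff mult_left_le_one_le)
  have strip: "nat \<lfloor>fst (x i) / h + 1 / 2\<rfloor> \<le> m" "nat \<lfloor>fst (x i) / h\<rfloor> \<le> m" if "i < n" for i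
    using u[OF that] by linarith+
  have 1: "tsp_opt dep x n \<le> 2 * D + real m * (1 + h) + 1
        + 2 * (\<Sum>i<n. \<bar>fst (x i) - (0 + h * nat \<lfloor>fst (x i) / h + 1 / 2\<rfloor>)\<bar>)"
    by (rule tsp_opt_le_strips[OF n h(1) sq strip(1) D])
  have 2: "tsp_opt dep x n \<le> 2 * D + real m * (1 + h) + 1
        + 2 * (\<Sum>i<n. \<bar>fst (x i) - (h / 2 + h * nat \<lfloor>fst (x i) / h\<rfloor>)\<bar>)"
    by (rule tsp_opt_le_strips[OF n h(1) sq strip(2) D])
  have "(\<Sum>i<n. \<bar>fst (x i) - (0 + h * nat \<lfloor>fst (x i) / h + 1 / 2\<rfloor>)\<bar>)
      + (\<Sum>i<n. \<bar>fst (x i) - (h / 2 + h * nat \<lfloor>fst (x i) / h\<rfloor>)\<bar>) = (\<Sum>i<n. h / 2)"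
    unfolding sum.distrib[symmetric]
    by (rule sum.cong) (use shifted_strips[OF h(1)] u in auto)
  with 1 2 have "tsp_opt dep x n \<le> 2 * D + real m + 2 + n * h / 2"
    using h(2) by (simp add: algebra_simps)
  moreover have "n * h / 2 \<le> sqrt (n / 2)"
  proof -
    have "real n / 2 = sqrt (n / 2) * sqrt (n / 2)" by simp
    also have "\<dots> \<le> sqrt (n / 2) * m" using m by (intro mult_left_mono) auto
    finally show ?thesis using m by (simp add: h_def field_simps)
  qed
  moreover have "2 * sqrt (n / 2) = sqrt 2 * sqrt n"
    by (simp add: real_sqrt_divide real_div_sqrt field_simps)
  ultimately show ?thesis using m by linarith
qed

section \<open>Uniform random points\<close>

abbreviation unit_square :: "point set" where
  "unit_square \<equiv> {0..1} \<times> {0..1}"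

abbreviation unif_square :: "point measure" where
  "unif_square \<equiv> uniform_measure lborel unit_square"

lemma emeasure_unit_square: "emeasure lborel unit_square = 1"
proof -
  have "emeasure (lborel \<Otimes>\<^sub>M lborel :: point measure) unit_square = 1"
    by (subst lborel.emeasure_pair_measure_Times) auto
  then show ?thesis by (simp add: lborel_prod)
qed

lemma unit_square_borel [measurable]: "unit_square \<in> sets borel"
  by (intro borel_closed closed_Times) auto

lemma prob_space_unif_square: "prob_space unif_square"
  by (intro prob_space_uniform_measure) (auto simp: emeasure_unit_square)

lemma emeasure_unif_square_ball_le:
  assumes "0 \<le> r"
  shows "emeasure unif_square {y. dist c y < r} \<le> ennreal (pi * r\<^sup>2)"
proof -
  have "{y. dist c y < r} = ball c r" by auto
  then have "emeasure unif_square {y. dist c y < r} = emeasure lborel (unit_square \<inter> ball c r)"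
    by (simp add: emeasure_unit_square borel_open divide_ennreal_def)
  also have "\<dots> \<le> emeasure lborel (ball c r)"
    by (intro emeasure_mono) auto
  also have "\<dots> = ennreal (pi * r\<^sup>2)"
    using assms by (simp add: emeasure_ball unit_ball_vol_2 power2_eq_square)
  finally show ?thesis .
qed

lemma sets_unif_points: "sets (unif_points n) = sets (PiM {..<n} (\<lambda>_. borel))"
  unfolding unif_points_def by (intro sets_PiM_cong) auto

lemma prob_space_unif_points: "prob_space (unif_points n)"
  unfolding unif_points_def by (intro prob_space_PiM prob_space_unif_square)

lemma measurable_unif_points [measurable]:
  "i < n \<Longrightarrow> (\<lambda>x. x i) \<in> borel_measurable (unif_points n)"
  unfolding measurable_cong_sets[OF sets_unif_points refl]
  by (intro measurable_component_singleton) auto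

lemma AE_unif_points_in_square: "AE x in unif_points n. \<forall>i<n. x i \<in> unit_square"
proof -
  have "AE x in unif_points n. x i \<in> unit_square" if "i < n" for i
    unfolding unif_points_def using that
    by (intro AE_PiM_component prob_space_unif_square AE_uniform_measureI) auto
  then have "AE x in unif_points n. \<forall>i\<in>{..<n}. x i \<in> unit_square"
    by (subst AE_ball_countable) (auto simp del: mem_Times_iff)
  then show ?thesis by eventually_elim simp
qed

section \<open>Probabilities and independence of close pairs\<close>

definition close_event :: "nat \<Rightarrow> real \<Rightarrow> nat \<times> nat \<Rightarrow> (nat \<Rightarrow> point) set" where
  "close_event n r = (\<lambda>(i, j). {x \<in> space (unif_points n). dist (x i) (x j) < r})"

lemma close_event_sets [measurable]:
  "i < n \<Longrightarrow> j < n \<Longrightarrow> close_event n r (i, j) \<in> sets (unif_points n)"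
  unfolding close_event_def prod.case by measurable

text \<open>Fubini with coordinate \<open>a\<close> in the outer integral: a uniform bound on the
  slices survives averaging because \<open>M a\<close> has mass 1.\<close>

lemma emeasure_PiM_le_of_slices:
  fixes M :: "'i \<Rightarrow> 'a measure"
  assumes "finite I" "a \<in> I" and M: "\<And>i. prob_space (M i)" and A: "A \<in> sets (PiM I M)"
    and le: "\<And>y. y \<in> space (M a) \<Longrightarrow>
      emeasure (PiM (I - {a}) M) {x \<in> space (PiM (I - {a}) M). x(a := y) \<in> A} \<le> C"
  shows "emeasure (PiM I M) A \<le> C"
proof -
  interpret product_prob_space M I
    by (intro product_prob_spaceI M)
  have I: "insert a (I - {a}) = I" using assms by auto
  have "emeasure (PiM I M) A = (\<integral>\<^sup>+ x. indicator A x \<partial>PiM (insert a (I - {a})) M)"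
    unfolding I using A by simp
  also have "\<dots> = (\<integral>\<^sup>+ y. \<integral>\<^sup>+ x. indicator A (x(a := y)) \<partial>PiM (I - {a}) M \<partial>M a)"
    using assms by (intro product_nn_integral_insert_rev) (auto simp: I insert_absorb)
  also have "\<dots> \<le> (\<integral>\<^sup>+ y. C \<partial>M a)"
  proof (rule nn_integral_mono)
    fix y assume y: "y \<in> space (M a)"
    let ?B = "{x \<in> space (PiM (I - {a}) M). x(a := y) \<in> A}"
    have "(\<lambda>x. x(a := y)) \<in> measurable (PiM (I - {a}) M) (PiM I M)"
      using y assms(2) by (intro measurable_fun_upd[of I "I - {a}"]) auto
    then have "?B \<in> sets (PiM (I - {a}) M)"
      using A by (auto simp: vimage_def Int_def conj_commute dest: measurable_sets)
    then have "emeasure (PiM (I - {a}) M) ?B = (\<integral>\<^sup>+ x. indicator ?B x \<partial>PiM (I - {a}) M)"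
      by (rule nn_integral_indicator[symmetric])
    also have "\<dots> = (\<integral>\<^sup>+ x. indicator A (x(a := y)) \<partial>PiM (I - {a}) M)"
      by (intro nn_integral_cong) (auto simp: indicator_def)
    finally show "(\<integral>\<^sup>+ x. indicator A (x(a := y)) \<partial>PiM (I - {a}) M) \<le> C" using le[OF y] by simp
  qed
  also have "\<dots> = C" by (simp add: M.emeasure_space_1)
  finally show ?thesis .
qed

text \<open>Conditionally on the point of index a, the events that other points lie close to it are
  independent.\<close>
lemma measure_close_to_le:
  assumes "0 \<le> r" "a < n" "J \<subseteq> {..<n}" "a \<notin> J"
  shows "measure (unif_points n) {x \<in> space (unif_points n). \<forall>j\<in>J. dist (x a) (x j) < r}
       \<le> (pi * r\<^sup>2) ^ card J"
proof -
  let ?A = "{x \<in> space (unif_points n). \<forall>j\<in>J. dist (x a) (x j) < r}"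
  have fin: "finite J" using assms finite_subset by blast
  have A: "?A \<in> sets (unif_points n)"
  proof -
    have [measurable]: "(\<lambda>x. dist (x a) (x j)) \<in> borel_measurable (unif_points n)" if "j \<in> J" for j
      using that assms by (intro borel_measurable_dist measurable_unif_points) auto
    show ?thesis using fin by measurable
  qed
  let ?P = "PiM ({..<n} - {a}) (\<lambda>_. unif_square)"
  interpret product_prob_space "\<lambda>_. unif_square" "{..<n} - {a}"
    by (intro product_prob_spaceI prob_space_unif_square)
  interpret Pts: prob_space "unif_points n" by (rule prob_space_unif_points)
  have "emeasure (unif_points n) ?A \<le> ennreal ((pi * r\<^sup>2) ^ card J)"
    unfolding unif_points_def
  proof (rule emeasure_PiM_le_of_slices)
    fix y :: point
    have "{x \<in> space ?P. x(a := y) \<in> {x \<in> space (PiM {..<n} (\<lambda>_. unif_square)). \<forall>j\<in>J. dist (x a) (x j) < r}}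
        = {x \<in> space ?P. \<forall>j\<in>J. x j \<in> {z. dist y z < r}}"
      using assms by (auto simp: space_PiM PiE_iff extensional_def)
    also have "emeasure ?P \<dots> = (\<Prod>j\<in>J. emeasure unif_square {z. dist y z < r})"
      using assms fin by (intro emeasure_PiM_Collect) (auto simp: borel_open open_ball[unfolded ball_def])
    also have "\<dots> \<le> (\<Prod>j\<in>J. ennreal (pi * r\<^sup>2))"
      using assms(1) by (intro prod_mono_ennreal emeasure_unif_square_ball_le)
    also have "\<dots> = ennreal ((pi * r\<^sup>2) ^ card J)" by (simp add: ennreal_power)
    finally show "emeasure ?P {x \<in> space ?P. x(a := y) \<in> {x \<in> space (PiM {..<n} (\<lambda>_. unif_square)). \<forall>j\<in>J. dist (x a) (x j) < r}}
       \<le> ennreal ((pi * r\<^sup>2) ^ card J)" .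
  qed (use assms A prob_space_unif_square in \<open>auto simp: unif_points_def\<close>)
  then show ?thesis by (simp add: Pts.emeasure_eq_measure ennreal_le_iff)
qed

text \<open>Each event depends only on the coordinates in its pair, and disjoint blocks of
  coordinates of a product measure are independent.\<close>

lemma close_events_indep:
  assumes "i < n" "j < n" "k < n" "l < n" "{i, j} \<inter> {k, l} = {}"
  shows "measure (unif_points n) (close_event n r (i, j) \<inter> close_event n r (k, l))
       = measure (unif_points n) (close_event n r (i, j)) * measure (unif_points n) (close_event n r (k, l))"
proof -
  let ?M = "\<lambda>_::nat. unif_square"
  interpret M: prob_space "unif_points n" by (rule prob_space_unif_points)
  have "distr (unif_points n) (PiM {..<n} ?M) (\<lambda>x. \<lambda>i\<in>{..<n}. x i) = distr (unif_points n) (unif_points n) (\<lambda>x. x)"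
    by (intro distr_cong) (auto simp: unif_points_def space_PiM)
  also have "\<dots> = PiM {..<n} ?M" by (simp add: unif_points_def)
  also have "\<dots> = PiM {..<n} (\<lambda>i. distr (unif_points n) unif_square (\<lambda>x. x i))"
    unfolding unif_points_def
    by (intro PiM_cong refl distr_PiM_component[symmetric] prob_space_unif_square) auto
  finally have ind: "M.indep_vars ?M (\<lambda>i x. x i) {..<n}"
    using assms by (subst M.indep_vars_iff_distr_eq_PiM') (auto simp: unif_points_def)
  define B where "B = (\<lambda>i j. {x \<in> space (PiM {i, j} ?M). dist (x i) (x j) < r})"
  have B: "B i j \<in> sets (PiM {i, j} ?M)" for i j :: nat
  proof -
    have comp: "(\<lambda>x. x k) \<in> borel_measurable (PiM {i, j} ?M)" if "k \<in> {i, j}" for k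
      using measurable_component_singleton[OF that, of ?M]
      by (subst measurable_cong_sets[OF refl, of borel unif_square]) auto
    have "(\<lambda>x. dist (x i) (x j)) \<in> borel_measurable (PiM {i, j} ?M)"
      by (intro borel_measurable_dist comp) auto
    then show ?thesis unfolding B_def by measurable
  qed
  have C: "close_event n r (i, j) = (\<lambda>x. \<lambda>i\<in>{i, j}. x i) -` B i j \<inter> space (unif_points n)" for i j
    by (auto simp: close_event_def B_def space_PiM)
  have "close_event n r (i, j) \<inter> close_event n r (k, l)
      = (\<lambda>x. (\<lambda>i\<in>{i, j}. x i, \<lambda>i\<in>{k, l}. x i)) -` (B i j \<times> B k l) \<inter> space (unif_points n)"
    unfolding C by auto
  then show ?thesis
    using M.indep_varD[OF M.indep_var_restrict[OF ind assms(5)] B B] assms unfolding C by simp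
qed

section \<open>Second moments of counts of events\<close>

lemma (in prob_space) integrable_indicator_event:
  "A \<in> events \<Longrightarrow> integrable M (indicator A :: 'a \<Rightarrow> real)"
  by (simp add: less_top[symmetric])

lemma (in prob_space) expectation_count:
  assumes "finite I" "\<And>p. p \<in> I \<Longrightarrow> A p \<in> events"
  shows "expectation (\<lambda>x. \<Sum>p\<in>I. indicator (A p) x :: real) = (\<Sum>p\<in>I. prob (A p))"
  using assms by (subst Bochner_Integration.integral_sum) (auto intro: integrable_indicator_event)

lemma (in prob_space) variance_count:
  assumes "finite I" and A[measurable]: "\<And>p. p \<in> I \<Longrightarrow> A p \<in> events"
  shows "variance (\<lambda>x. \<Sum>p\<in>I. indicator (A p) x)
       = (\<Sum>p\<in>I. \<Sum>q\<in>I. prob (A p \<inter> A q) - prob (A p) * prob (A q))"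
proof -
  let ?Z = "\<lambda>x. \<Sum>p\<in>I. indicator (A p) x :: real"
  have sq: "(?Z x)\<^sup>2 = (\<Sum>p\<in>I. \<Sum>q\<in>I. indicator (A p \<inter> A q) x)" for x
    unfolding power2_eq_square sum_product by (simp add: indicator_inter_arith)
  have Z: "integrable M ?Z"
    using A by (intro Bochner_Integration.integrable_sum integrable_indicator_event)
  have Z2: "integrable M (\<lambda>x. (?Z x)\<^sup>2)"
    unfolding sq using A
    by (intro Bochner_Integration.integrable_sum integrable_indicator_event) auto
  have "expectation (\<lambda>x. (?Z x)\<^sup>2) = (\<Sum>p\<in>I. \<Sum>q\<in>I. prob (A p \<inter> A q))"
    unfolding sq using A assms(1)
    by (simp add: Bochner_Integration.integral_sum integrable_indicator_event sets.Int)
  then show ?thesis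
    using variance_eq[OF Z Z2] expectation_count[of I A] assms
    by (simp add: power2_eq_square sum_product sum_subtractf)
qed

text \<open>Chebyshev's inequality: the variance is the sum of all entries of the covariance matrix,
  and \<open>v\<close> bounds each row.\<close>

lemma (in prob_space) prob_count_ge:
  fixes v t :: real
  assumes I: "finite I" and A[measurable]: "\<And>p. p \<in> I \<Longrightarrow> A p \<in> events"
    and t: "0 < t"
    and V: "\<And>p. p \<in> I \<Longrightarrow> (\<Sum>q\<in>I. prob (A p \<inter> A q) - prob (A p) * prob (A q)) \<le> v"
  shows "prob {x \<in> space M. (\<Sum>p\<in>I. prob (A p)) + t \<le> (\<Sum>p\<in>I. indicator (A p) x)} \<le> card I * v / t\<^sup>2"
proof -
  let ?Z = "\<lambda>x. \<Sum>p\<in>I. indicator (A p) x :: real"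
  have sq: "(?Z x)\<^sup>2 = (\<Sum>p\<in>I. \<Sum>q\<in>I. indicator (A p \<inter> A q) x)" for x
    unfolding power2_eq_square sum_product by (simp add: indicator_inter_arith)
  have Z[measurable]: "?Z \<in> borel_measurable M" using A by auto
  have "prob {x \<in> space M. (\<Sum>p\<in>I. prob (A p)) + t \<le> ?Z x}
      \<le> prob {x \<in> space M. \<bar>?Z x - expectation ?Z\<bar> \<ge> t}"
    using expectation_count[of I A] I A by (intro finite_measure_mono) auto
  also have "\<dots> \<le> variance ?Z / t\<^sup>2"
  proof (rule Chebyshev_inequality[OF Z _ t])
    show "integrable M (\<lambda>x. (?Z x)\<^sup>2)"
      unfolding sq using A
    by (intro Bochner_Integration.integrable_sum integrable_indicator_event) auto
  qed
  also have "variance ?Z = (\<Sum>p\<in>I. \<Sum>q\<in>I. prob (A p \<inter> A q) - prob (A p) * prob (A q))"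
    using I A by (rule variance_count)
  also have "\<dots> \<le> card I * v"
    using V by (rule sum_bounded_above)
  finally show ?thesis by (simp add: divide_right_mono)
qed

section \<open>Concentration of the number of close pairs\<close>

definition index_pairs :: "nat \<Rightarrow> (nat \<times> nat) set" where
  "index_pairs n = {(i, j). i < j \<and> j < n}"

lemma finite_index_pairs [simp]: "finite (index_pairs n)"
  by (rule finite_subset[of _ "{..<n} \<times> {..<n}"]) (auto simp: index_pairs_def)

lemma card_index_pairs: "2 * card (index_pairs n) \<le> n\<^sup>2"
proof -
  let ?S = "prod.swap ` index_pairs n"
  have "card (index_pairs n) + card ?S = card (index_pairs n \<union> ?S)"
    by (rule card_Un_disjoint[symmetric]) (simp, simp, auto simp: index_pairs_def)
  also have "\<dots> \<le> card ({..<n} \<times> {..<n})"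
    by (intro card_mono) (auto simp: index_pairs_def)
  finally show ?thesis by (simp add: card_image power2_eq_square)
qed

lemma card_close_pairs:
  assumes "x \<in> space (unif_points n)"
  shows "real (card (close_pairs x r {..<n})) = (\<Sum>p\<in>index_pairs n. indicator (close_event n r p) x)"
proof -
  have "close_pairs x r {..<n} = {p \<in> index_pairs n. x \<in> close_event n r p}"
    using assms by (auto simp: close_pairs_def index_pairs_def close_event_def)
  then show ?thesis
    by (simp add: indicator_def Collect_conj_eq)
qed

lemma close_event_index_pairs_sets:
  "p \<in> index_pairs n \<Longrightarrow> close_event n r p \<in> sets (unif_points n)"
  by (cases p) (auto simp: index_pairs_def intro!: close_event_sets)

lemma measure_close_event_le:
  assumes "0 \<le> r" "p \<in> index_pairs n"
  shows "measure (unif_points n) (close_event n r p) \<le> pi * r\<^sup>2"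
  using measure_close_to_le[of r "fst p" n "{snd p}"] assms
  by (cases p) (auto simp: index_pairs_def close_event_def)

text \<open>Different increasing pairs that meet share exactly one index \<open>a\<close>. The two
  other points must both be within \<open>r\<close> of the point \<open>a\<close>, and given that
  point they are independent.\<close>

lemma measure_close_events_overlap_le:
  assumes r: "0 \<le> r" and p: "p \<in> index_pairs n" "q \<in> index_pairs n" "p \<noteq> q"
    and overlap: "{fst p, snd p} \<inter> {fst q, snd q} \<noteq> {}"
  shows "measure (unif_points n) (close_event n r p \<inter> close_event n r q) \<le> (pi * r\<^sup>2)\<^sup>2"
proof -
  interpret M: prob_space "unif_points n" by (rule prob_space_unif_points)
  obtain i j k l where ij: "p = (i, j)" "q = (k, l)" "i < j" "j < n" "k < l" "l < n"
    using p by (auto simp: index_pairs_def)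
  have *: ?thesis
    if "a < n" "b < n" "c < n" "a \<noteq> b" "a \<noteq> c" "b \<noteq> c" "{i, j} = {a, b}" "{k, l} = {a, c}" for a b c
  proof -
    let ?B = "{x \<in> space (unif_points n). \<forall>z\<in>{b, c}. dist (x a) (x z) < r}"
    have "close_event n r p \<inter> close_event n r q \<subseteq> ?B"
      using that(7,8) by (auto simp: ij close_event_def doubleton_eq_iff dist_commute)
    then have "measure (unif_points n) (close_event n r p \<inter> close_event n r q) \<le> measure (unif_points n) ?B"
    proof (rule M.finite_measure_mono)
      have "?B = close_event n r (a, b) \<inter> close_event n r (a, c)"
        by (auto simp: close_event_def)
      then show "?B \<in> M.events" using that by auto
    qed
    also have "\<dots> \<le> (pi * r\<^sup>2) ^ card {b, c}"
      using that r by (intro measure_close_to_le) auto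
    finally show ?thesis using that by (simp add: power2_eq_square)
  qed
  from overlap consider "i = k" | "i = l" | "j = k" | "j = l" by (auto simp: ij)
  then show ?thesis
  proof cases
    case 1 then show ?thesis using *[of i j l] ij p(3) by auto
  next
    case 2 then show ?thesis using *[of i j k] ij by auto
  next
    case 3 then show ?thesis using *[of j i l] ij by auto
  next
    case 4 then show ?thesis using *[of j i k] ij p(3) by auto
  qed
qed

text \<open>Disjoint pairs have covariance 0, which leaves \<open>p\<close> itself and at most
  \<open>4 * n\<close> pairs that share an index with it. For \<open>r\<close> of order 1 / sqrt n
  the row sum is O(1 / n).\<close>

lemma sum_covariance_close_events_le:
  assumes r: "0 \<le> r" and p: "p \<in> index_pairs n"
  shows "(\<Sum>q\<in>index_pairs n. measure (unif_points n) (close_event n r p \<inter> close_event n r q)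
            - measure (unif_points n) (close_event n r p) * measure (unif_points n) (close_event n r q))
       \<le> pi * r\<^sup>2 + 4 * real n * (pi * r\<^sup>2)\<^sup>2" (is "(\<Sum>q\<in>_. ?cov q) \<le> _")
proof -
  obtain i j where ij: "p = (i, j)" "i < j" "j < n" using p by (auto simp: index_pairs_def)
  define S where "S = {i, j} \<times> {..<n} \<union> {..<n} \<times> {i, j}"
  have S: "finite S" "card S \<le> 4 * n"
    using card_Un_le[of "{i, j} \<times> {..<n}" "{..<n} \<times> {i, j}"] ij by (auto simp: S_def)
  have "?cov q \<le> (if q = p then pi * r\<^sup>2 else 0) + (if q \<in> S then (pi * r\<^sup>2)\<^sup>2 else 0)"
    if q: "q \<in> index_pairs n" for q
  proof (cases "q = p")
    case True
    have "?cov q \<le> pi * r\<^sup>2"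
      using measure_close_event_le[OF r p] True
        mult_nonneg_nonneg[OF measure_nonneg[of "unif_points n" "close_event n r p"] measure_nonneg]
      by (simp add: diff_le_eq add_increasing2)
    then show ?thesis using True by (simp add: add_increasing2)
  next
    case False
    show ?thesis
    proof (cases "q \<in> S")
      case True
      then have "{fst p, snd p} \<inter> {fst q, snd q} \<noteq> {}" by (auto simp: S_def ij)
      from measure_close_events_overlap_le[OF r p q _ this]
      have "?cov q \<le> (pi * r\<^sup>2)\<^sup>2" using False by (simp add: diff_le_eq add_increasing2)
      then show ?thesis using True False by simp
    next
      case notin: False
      obtain k l where q': "q = (k, l)" "k < n" "l < n" using q by (auto simp: index_pairs_def)
      then have "{i, j} \<inter> {k, l} = {}" using notin by (auto simp: S_def)
      then show ?thesis
        using close_events_indep[of i n j k l r] ij q' False by simp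
    qed
  qed
  then have "(\<Sum>q\<in>index_pairs n. ?cov q)
      \<le> (\<Sum>q\<in>index_pairs n. (if q = p then pi * r\<^sup>2 else 0) + (if q \<in> S then (pi * r\<^sup>2)\<^sup>2 else 0))"
    by (rule sum_mono)
  also have "\<dots> = pi * r\<^sup>2 + (\<Sum>q\<in>index_pairs n \<inter> S. (pi * r\<^sup>2)\<^sup>2)"
    using p by (simp add: sum.distrib flip: sum.inter_restrict)
  also have "\<dots> \<le> pi * r\<^sup>2 + 4 * real n * (pi * r\<^sup>2)\<^sup>2"
  proof -
    have "card (index_pairs n \<inter> S) \<le> 4 * n"
      using S card_mono[of S "index_pairs n \<inter> S"] by auto
    then have "real (card (index_pairs n \<inter> S)) \<le> 4 * n" by linarith
    then show ?thesis by (simp add: mult_right_mono)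
  qed
  finally show ?thesis .
qed

text \<open>The mean is at most (n^2 / 2) (c / n) = c n / 2. At most n^2 / 2 rows of size O(1 / n)
  give variance O(n), so an excess of \<open>d * n\<close> has probability O(1 / n).\<close>

lemma measure_many_close_pairs_le:
  assumes n: "1 \<le> n" and d: "0 < d" and s: "0 \<le> s"
  defines "c \<equiv> pi * s\<^sup>2"
  shows "{x \<in> space (unif_points n). (c / 2 + d) * n \<le> card (close_pairs x (s / sqrt n) {..<n})}
           \<in> sets (unif_points n)" (is "?B \<in> _")
    and "measure (unif_points n)
           {x \<in> space (unif_points n). (c / 2 + d) * n \<le> card (close_pairs x (s / sqrt n) {..<n})}
           \<le> (c + 4 * c\<^sup>2) / (2 * d\<^sup>2) / n"
proof -
  interpret M: prob_space "unif_points n" by (rule prob_space_unif_points)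
  let ?I = "index_pairs n" and ?r = "s / sqrt n"
  let ?A = "close_event n ?r"
  have B: "?B = {x \<in> space (unif_points n). (c / 2 + d) * n \<le> (\<Sum>p\<in>?I. indicator (?A p) x)}"
    using card_close_pairs by auto
  have [measurable]: "?A p \<in> M.events" if "p \<in> ?I" for p
    using that by (rule close_event_index_pairs_sets)
  show "?B \<in> sets (unif_points n)" unfolding B by measurable
  have r: "0 \<le> ?r" "pi * ?r\<^sup>2 = c / n"
    using n s by (auto simp: c_def power_divide)
  have c: "0 \<le> c" by (simp add: c_def)
  have card: "real (card ?I) \<le> (real n)\<^sup>2 / 2"
  proof -
    have "real (2 * card ?I) \<le> real (n\<^sup>2)"
      using card_index_pairs[of n] by (simp only: of_nat_le_iff)
    then show ?thesis by simp
  qed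
  have "(\<Sum>p\<in>?I. M.prob (?A p)) \<le> card ?I * (c / n)"
    using measure_close_event_le[OF r(1)] unfolding r(2) by (intro sum_bounded_above) auto
  also have "\<dots> \<le> (real n)\<^sup>2 / 2 * (c / n)"
    using card c by (intro mult_right_mono) auto
  finally have "(\<Sum>p\<in>?I. M.prob (?A p)) + d * n \<le> (c / 2 + d) * n"
    using n by (simp add: power2_eq_square field_simps)
  then have "M.prob ?B \<le> M.prob {x \<in> space (unif_points n).
      (\<Sum>p\<in>?I. M.prob (?A p)) + d * n \<le> (\<Sum>p\<in>?I. indicator (?A p) x)}"
    unfolding B by (intro M.finite_measure_mono) auto
  also have "\<dots> \<le> card ?I * (pi * ?r\<^sup>2 + 4 * n * (pi * ?r\<^sup>2)\<^sup>2) / (d * n)\<^sup>2"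
    using n d r sum_covariance_close_events_le[OF r(1)]
    by (intro M.prob_count_ge) (auto simp: close_event_index_pairs_sets)
  also have "\<dots> \<le> (real n)\<^sup>2 / 2 * (c / n + 4 * n * (c / n)\<^sup>2) / (d * n)\<^sup>2"
    unfolding r(2) using card c by (intro divide_right_mono mult_right_mono) auto
  also have "\<dots> = (c + 4 * c\<^sup>2) / (2 * d\<^sup>2) / n"
    using n d by (simp add: power2_eq_square field_simps)
  finally show "M.prob ?B \<le> (c + 4 * c\<^sup>2) / (2 * d\<^sup>2) / n" .
qed

text \<open>Markov's inequality suffices, since \<open>e\<close> will tend to 0 while
  \<open>d\<close> stays fixed.\<close>

lemma measure_many_near_le:
  fixes d e :: real
  assumes n: "1 \<le> n" and d: "0 < d" and e: "0 \<le> e"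
  shows "{x \<in> space (unif_points n). d * n \<le> card {i. i < n \<and> dist q (x i) < e}} \<in> sets (unif_points n)"
      (is "?B \<in> _")
    and "measure (unif_points n) {x \<in> space (unif_points n). d * n \<le> card {i. i < n \<and> dist q (x i) < e}}
           \<le> pi * e\<^sup>2 / d"
proof -
  interpret Pts: prob_space "unif_points n" by (rule prob_space_unif_points)
  let ?A = "\<lambda>i. {x \<in> space (unif_points n). dist q (x i) < e}"
  have ev[measurable]: "?A i \<in> Pts.events" if "i \<in> {..<n}" for i
  proof -
    have "(\<lambda>x. dist q (x i)) \<in> borel_measurable (unif_points n)"
      using that by (intro borel_measurable_dist borel_measurable_const measurable_unif_points) auto
    then show ?thesis by measurable
  qed
  have "real (card {i. i < n \<and> dist q (x i) < e}) = (\<Sum>i<n. indicator (?A i) x)"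
    if "x \<in> space (unif_points n)" for x
  proof -
    have "(\<Sum>i<n. indicator (?A i) x) = (\<Sum>i<n. if dist q (x i) < e then 1 else 0 :: real)"
      using that by (intro sum.cong) (auto simp: indicator_def)
    also have "\<dots> = (\<Sum>i\<in>{i \<in> {..<n}. dist q (x i) < e}. 1)"
      by (rule sum.inter_filter[symmetric]) simp
    finally show ?thesis by simp
  qed
  then have B: "?B = {x \<in> space (unif_points n). d * n \<le> (\<Sum>i<n. indicator (?A i) x)}"
    by auto
  show "?B \<in> sets (unif_points n)" unfolding B by measurable
  have A: "Pts.prob (?A i) \<le> pi * e\<^sup>2" if "i < n" for i
  proof -
    interpret product_prob_space "\<lambda>_. unif_square" "{..<n}"
      by (intro product_prob_spaceI prob_space_unif_square)
    have "emeasure (unif_points n) (?A i) = emeasure unif_square {y. dist q y < e}"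
      using emeasure_PiM_Collect_single[of i "{y. dist q y < e}"] that
      by (simp add: unif_points_def borel_open open_ball[unfolded ball_def])
    also have "\<dots> \<le> ennreal (pi * e\<^sup>2)" by (rule emeasure_unif_square_ball_le[OF e])
    finally show ?thesis by (simp add: Pts.emeasure_eq_measure)
  qed
  have int: "integrable (unif_points n) (\<lambda>x. \<Sum>i<n. indicator (?A i) x :: real)"
    by (intro Bochner_Integration.integrable_sum Pts.integrable_indicator_event ev)
  have "Pts.prob ?B \<le> Pts.expectation (\<lambda>x. \<Sum>i<n. indicator (?A i) x) / (d * n)"
    unfolding B using n d
    by (intro integral_Markov_inequality_measure[OF int, where A = "{}"]) (auto intro!: sum_nonneg)
  also have "\<dots> = (\<Sum>i<n. Pts.prob (?A i)) / (d * n)"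
    by (subst Pts.expectation_count[OF _ ev]) simp_all
  also have "\<dots> \<le> (real n * (pi * e\<^sup>2)) / (d * n)"
    using n d sum_bounded_above[of "{..<n}" "\<lambda>i. Pts.prob (?A i)" "pi * e\<^sup>2"] A
    by (intro divide_right_mono) auto
  also have "\<dots> = pi * e\<^sup>2 / d" using n by simp
  finally show "Pts.prob ?B \<le> pi * e\<^sup>2 / d" .
qed

section \<open>The approximation ratio\<close>

text \<open>Reduces a bound on the infimum to disjoint nonempty tours, by
  \<open>exists_partition_tours\<close>.\<close>

lemma cvrp_opt_ge:
  assumes n: "1 \<le> n" and k: "1 \<le> k" and c: "0 < c"
    and le: "\<And>ts. distinct (concat ts) \<Longrightarrow> set (concat ts) = {..<n} \<Longrightarrow>
      \<forall>t\<in>set ts. length t \<le> k \<and> t \<noteq> [] \<Longrightarrow> B \<le> c * (\<Sum>t\<leftarrow>ts. tour_cost dep (map x t))"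
  shows "B \<le> c * cvrp_opt dep x n k"
proof -
  have "B / c \<le> cvrp_opt dep x n k"
    unfolding cvrp_opt_def
  proof (rule cInf_greatest)
    \<comment> \<open>One tour per customer is feasible, so the infimum is over a nonempty
      set.\<close>
    have "(\<forall>t\<in>set (map (\<lambda>i. [i]) [0..<n]). length t \<le> k) \<and>
        (\<Union>t\<in>set (map (\<lambda>i. [i]) [0..<n]). set t) = {..<n}"
      using k by auto
    then show "{(\<Sum>t\<leftarrow>tours. tour_cost dep (map x t)) | tours.
       (\<forall>t\<in>set tours. length t \<le> k) \<and> (\<Union>t\<in>set tours. set t) = {..<n}} \<noteq> {}"
      by blast
  next
    fix z assume "z \<in> {(\<Sum>t\<leftarrow>tours. tour_cost dep (map x t)) | tours.
       (\<forall>t\<in>set tours. length t \<le> k) \<and> (\<Union>t\<in>set tours. set t) = {..<n}}"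
    then obtain tours where z: "z = (\<Sum>t\<leftarrow>tours. tour_cost dep (map x t))"
      and tours: "\<forall>t\<in>set tours. length t \<le> k" "(\<Union>t\<in>set tours. set t) = {..<n}"
      by auto
    obtain ts where ts: "\<forall>t\<in>set ts. length t \<le> k \<and> t \<noteq> []" "distinct (concat ts)"
        "set (concat ts) = (\<Union>t\<in>set tours. set t)"
        "(\<Sum>t\<leftarrow>ts. tour_cost dep (map x t)) \<le> z"
      using exists_partition_tours[OF tours(1), of dep x] unfolding z by blast
    have "B \<le> c * (\<Sum>t\<leftarrow>ts. tour_cost dep (map x t))"
      using ts tours(2) by (intro le) (simp_all del: set_concat)
    also have "\<dots> \<le> c * z" using ts(4) c by simp
    finally show "B / c \<le> z" using c by (simp add: field_simps)
  qed
  then show ?thesis using c by (simp add: field_simps)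
qed

text \<open>Since the tours of a solution form a travelling salesman tour, the optimal tour length A is
  at most the cost z, so either A is at most 0.915 z, or the number of tours is negligible and z
  exceeds the radial cost by 0.085 A. The thresholds 0.28 and 0.5 and the weights 0.88 and 0.6 are
  chosen to bring the coefficient of sqrt n in the lower bound above 0.085 sqrt 2; 0.134 and 0.403
  exceed the expected numbers pi s^2 / 2 of close pairs per point by about 0.01.\<close>
lemma itp_bound:
  fixes x :: "nat \<Rightarrow> point" and K e :: real
  assumes n: "1 \<le> n" and k: "1 \<le> k" and \<alpha>: "1 \<le> \<alpha>"
    and \<sigma>: "is_ordering n \<sigma>" "tour_cost dep (map x \<sigma>) \<le> \<alpha> * tsp_opt dep x n"
    and tsp: "tsp_opt dep x n \<le> sqrt 2 * sqrt n + K"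
    and close1: "card (close_pairs x (0.28 / sqrt n) {..<n}) \<le> 0.134 * n"
    and close2: "card (close_pairs x (0.5 / sqrt n) {..<n}) \<le> 0.403 * n"
    and near: "card {i. i < n \<and> dist dep (x i) < e} \<le> 0.005 * n"
    and e: "0 < e" "(sqrt 2 * sqrt n + K) / 0.915 / (2 * e) \<le> 0.005 * n"
    and large: "0.085 * (sqrt 2 * sqrt n + K) \<le> 0.14 * sqrt n"
  shows "ITP dep k (map x \<sigma>) \<le> (0.915 + \<alpha>) * cvrp_opt dep x n k"
proof -
  define R where "R = 2 / k * (\<Sum>i<n. dist dep (x i))"
  let ?A = "tsp_opt dep x n"
  have \<sigma>': "distinct \<sigma>" "set \<sigma> = {..<n}"
    using \<sigma>(1) by (simp_all add: is_ordering_def)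
  have \<sigma>_ne: "\<sigma> \<noteq> []"
  proof
    assume "\<sigma> = []"
    then have "0 \<notin> {..<n}" using \<sigma>'(2) by (metis empty_iff list.set(1))
    then show False using n by (simp only: lessThan_iff)
  qed
  have "(\<Sum>p\<leftarrow>map x \<sigma>. dist dep p) = (\<Sum>i<n. dist dep (x i))"
    using \<sigma>' by (simp add: sum_list_distinct_conv_sum_set comp_def)
  then have ITP: "ITP dep k (map x \<sigma>) \<le> \<alpha> * ?A + R"
    using ITP_le[OF k, of "map x \<sigma>" dep] \<sigma>_ne \<sigma>(2) by (simp add: R_def)
  show ?thesis
  proof (rule cvrp_opt_ge[OF n k])
    fix ts :: "nat list list"
    assume ts: "distinct (concat ts)" "set (concat ts) = {..<n}"
      "\<forall>t\<in>set ts. length t \<le> k \<and> t \<noteq> []"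
    define z where "z = (\<Sum>t\<leftarrow>ts. tour_cost dep (map x t))"
    have Az: "?A \<le> z" unfolding z_def by (rule tsp_opt_le_tours[OF ts(1,2)])
    \<comment> \<open>Splitting \<alpha> as 1 + (\<alpha> - 1) reduces the claim to the case
      \<alpha> = 1, which is \<open>R + ?A \<le> 1.915 * z\<close>.\<close>
    then have \<alpha>A: "\<alpha> * ?A \<le> ?A + (\<alpha> - 1) * z"
      using mult_left_mono[OF Az, of "\<alpha> - 1"] \<alpha> by (simp add: algebra_simps)
    have "R + ?A \<le> 1.915 * z"
    proof (cases "?A \<le> 0.915 * z")
      case True
      then show ?thesis
        using radial_lower_bound[OF ts, of dep x]
        unfolding z_def[symmetric] R_def[symmetric] by simp
    next
      case False
      let ?s = "sqrt n" and ?N = "real (length ts)"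
      have s: "0 < ?s" using n by simp
      have scale: "a / ?s * (b * n) = b * ?s * a" for a b :: real
      proof -
        have "a / ?s * (b * n) = a * b * (n / ?s)" by simp
        then show ?thesis by (simp only: real_div_sqrt of_nat_0_le_iff mult.commute mult.left_commute)
      qed
      \<comment> \<open>Here \<open>z\<close> is less than \<open>?A / 0.915\<close>, hence O(sqrt
        n). The allowance 0.01 n for tours is split evenly between those charged to their cost and
        those charged to a customer near the depot.\<close>
      define w where "w = z / (2 * e)"
      have "z / (2 * e) \<le> (sqrt 2 * sqrt n + K) / 0.915 / (2 * e)"
        using False tsp e(1) by (intro divide_right_mono) auto
      then have "w \<le> 0.005 * n" unfolding w_def using e(2) by (rule order_trans)
      moreover have "?N \<le> card {i. i < n \<and> dist dep (x i) < e} + w"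
        unfolding w_def z_def using ts(3) by (intro number_of_tours_le[OF e(1) ts(1,2)]) blast
      ultimately have N: "?N \<le> 0.01 * n" using near by simp
      define c1 where "c1 = real (card (close_pairs x (0.28 / ?s) {..<n}))"
      define c2 where "c2 = real (card (close_pairs x (0.5 / ?s) {..<n}))"
      have rs: "0 \<le> 0.28 / ?s" "0.28 / ?s \<le> 0.5 / ?s"
        using s by (auto intro!: divide_right_mono simp del: divide_divide_eq_left)
      have "R + 0.28 / ?s * (0.88 * (real n - ?N - c1) - 0.88\<^sup>2 * n / 2)
          + (0.5 / ?s - 0.28 / ?s) * (0.6 * (real n - ?N - c2) - 0.6\<^sup>2 * n / 2) \<le> z"
        unfolding z_def R_def c1_def c2_def by (intro tours_lower_bound[OF rs _ _ ts]) auto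
      \<comment> \<open>0.88 (1 - 0.01 - 0.134) - 0.88^2 / 2 = 0.36608, and in the next estimate 0.6
        (1 - 0.01 - 0.403) - 0.6^2 / 2 = 0.1722. The slopes 0.88 and 0.6 are close to 1 - pi s^2 / 2
        for the two thresholds.\<close>
      moreover have "0.366 * ?s * 0.28 \<le> 0.28 / ?s * (0.88 * (real n - ?N - c1) - 0.88\<^sup>2 * n / 2)"
      proof -
        have "0.366 * real n \<le> 0.88 * (real n - ?N - c1) - 0.88\<^sup>2 * n / 2"
          using N close1[folded c1_def] by (simp add: power2_eq_square field_simps)
        then have "0.28 / ?s * (0.366 * n) \<le> 0.28 / ?s * (0.88 * (real n - ?N - c1) - 0.88\<^sup>2 * n / 2)"
          using s by (intro mult_left_mono) auto
        then show ?thesis unfolding scale .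
      qed
      moreover have "0.172 * ?s * 0.22 \<le> (0.5 / ?s - 0.28 / ?s) * (0.6 * (real n - ?N - c2) - 0.6\<^sup>2 * n / 2)"
      proof -
        have "0.172 * real n \<le> 0.6 * (real n - ?N - c2) - 0.6\<^sup>2 * n / 2"
          using N close2[folded c2_def] by (simp add: power2_eq_square field_simps)
        then have "0.22 / ?s * (0.172 * n) \<le> 0.22 / ?s * (0.6 * (real n - ?N - c2) - 0.6\<^sup>2 * n / 2)"
          using s by (intro mult_left_mono) auto
        moreover have "0.5 / ?s - 0.28 / ?s = 0.22 / ?s" by (simp add: diff_divide_distrib[symmetric])
        ultimately show ?thesis by (simp only: scale)
      qed
      moreover have "R + u + v \<le> z" if "R + u' + v' \<le> z" "u \<le> u'" "v \<le> v'" for u u' v v'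
        using that by linarith
      ultimately have "R + 0.366 * ?s * 0.28 + 0.172 * ?s * 0.22 \<le> z" by blast
      \<comment> \<open>0.366 * 0.28 + 0.172 * 0.22 = 0.14032.\<close>
      moreover have "R + 0.14 * u \<le> z" if "R + 0.366 * u * 0.28 + 0.172 * u * 0.22 \<le> z" "0 < u" for u
        using that by simp
      ultimately have "R + 0.14 * ?s \<le> z" using s by blast
      \<comment> \<open>R \<le> z - 0.085 A gives R + A \<le> z + 0.915 A, and A \<le> z. This is
        the source of 0.915 = 1 - 0.085.\<close>
      moreover have "R + ?A \<le> 1.915 * z" if "R + u \<le> z" "0.085 * w \<le> u" "?A \<le> w" "?A \<le> z" for u w
        using that by simp
      ultimately show ?thesis using large tsp Az by blast
    qed
    with ITP \<alpha>A show "ITP dep k (map x \<sigma>) \<le> (0.915 + \<alpha>) * z"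
      by (simp add: algebra_simps)
  qed (use \<alpha> in simp)
qed

lemma eventually_large:
  fixes K :: real
  shows "\<forall>\<^sub>F n in sequentially. 1 \<le> n
      \<and> (sqrt 2 * sqrt (real n) + K) / 0.915 / (2 * real n powr (- 1 / 4)) \<le> 0.005 * real n
      \<and> 0.085 * (sqrt 2 * sqrt (real n) + K) \<le> 0.14 * sqrt (real n)"
proof (intro eventually_conj)
  show "\<forall>\<^sub>F n in sequentially. (sqrt 2 * sqrt (real n) + K) / 0.915 / (2 * real n powr (- 1 / 4)) \<le> 0.005 * real n"
    by real_asymp
  have "sqrt 2 \<le> 1.5" by (rule real_le_lsqrt) (auto simp: power2_eq_square)
  then have le: "0.085 * (sqrt 2 * sqrt (real n) + K) \<le> 0.085 * (1.5 * sqrt (real n) + K)" for n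
    by (intro mult_left_mono add_right_mono mult_right_mono) auto
  have "\<forall>\<^sub>F n in sequentially. 0.085 * (1.5 * sqrt (real n) + K) \<le> 0.14 * sqrt (real n)"
    by real_asymp
  then show "\<forall>\<^sub>F n in sequentially. 0.085 * (sqrt 2 * sqrt (real n) + K) \<le> 0.14 * sqrt (real n)"
    by (rule eventually_mono) (rule order_trans[OF le])
qed (rule eventually_ge_at_top)

text \<open>For an arbitrary choice \<open>T\<close> of tours, the set where the ratio bound holds
  need not be measurable. Therefore measurable events \<open>E n\<close> inside it are asked to have
  probability tending to 1.\<close>

theorem theorem2:
  fixes \<alpha> :: real and dep :: point and k :: "nat \<Rightarrow> nat"
    and T :: "nat \<Rightarrow> (nat \<Rightarrow> point) \<Rightarrow> nat list"
  assumes "\<alpha> \<ge> 1"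
    and "\<And>n. n \<ge> 1 \<Longrightarrow> 1 \<le> k n \<and> k n \<le> n"
    and "\<And>n x. is_ordering n (T n x) \<and>
                 tour_cost dep (map x (T n x)) \<le> \<alpha> * tsp_opt dep x n"
  shows "\<exists>E. (\<forall>n. E n \<in> sets (unif_points n)) \<and>
             (\<lambda>n. measure (unif_points n) (E n)) \<longlonglongrightarrow> 1 \<and>
             (\<forall>n\<ge>1. \<forall>x\<in>E n.
                ITP dep (k n) (map x (T n x)) / cvrp_opt dep x n (k n) \<le> 0.915 + \<alpha>)"
proof -
  define K where "K = 2 * (norm dep + 2) + 3"
  \<comment> \<open>Any exponent strictly between -1/2 and 0 would serve: \<open>e n\<close> must
    tend to 0, and sqrt n / \<open>e n\<close> must be o(n).\<close>
  define e where "e = (\<lambda>n::nat. real n powr (- 1 / 4))"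
  define large where "large = (\<lambda>n::nat. 1 \<le> n \<and> (sqrt 2 * sqrt (real n) + K) / 0.915 / (2 * e n) \<le> 0.005 * real n
      \<and> 0.085 * (sqrt 2 * sqrt (real n) + K) \<le> 0.14 * sqrt (real n))"
  \<comment> \<open>The slacks make \<open>c1 / 2 + d1\<close> and \<open>c2 / 2 + d2\<close> equal
    to the limits 0.134 and 0.403 of \<open>itp_bound\<close>.\<close>
  define c1 d1 c2 d2 where "c1 = pi * 0.28\<^sup>2" and "d1 = 0.134 - c1 / 2"
    and "c2 = pi * 0.5\<^sup>2" and "d2 = 0.403 - c2 / 2"
  have d: "0 < d1" "0 < d2"
    using pi_approx by (auto simp: d1_def d2_def c1_def c2_def power2_eq_square)
  define Q where "Q = (\<lambda>n. {x \<in> space (unif_points n). \<forall>i\<in>{..<n}. x i \<in> unit_square})"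
  define B1 where "B1 = (\<lambda>n. {x \<in> space (unif_points n).
      (c1 / 2 + d1) * n \<le> card (close_pairs x (0.28 / sqrt n) {..<n})})"
  define B2 where "B2 = (\<lambda>n. {x \<in> space (unif_points n).
      (c2 / 2 + d2) * n \<le> card (close_pairs x (0.5 / sqrt n) {..<n})})"
  define B3 where "B3 = (\<lambda>n. {x \<in> space (unif_points n).
      0.005 * real n \<le> card {i. i < n \<and> dist dep (x i) < e n}})"
  \<comment> \<open>For small \<open>n\<close> the event is empty and the ratio bound vacuous, which
    does not affect the limit.\<close>
  define E where "E = (\<lambda>n. if large n then Q n - (B1 n \<union> B2 n \<union> B3 n) else {})"
  define b where "b = (\<lambda>n. (c1 + 4 * c1\<^sup>2) / (2 * d1\<^sup>2) / real n + (c2 + 4 * c2\<^sup>2) / (2 * d2\<^sup>2) / real n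
      + pi * (e n)\<^sup>2 / 0.005)"

  have B: "B1 n \<in> sets (unif_points n)" "B2 n \<in> sets (unif_points n)" "B3 n \<in> sets (unif_points n)"
      "measure (unif_points n) (B1 n) \<le> (c1 + 4 * c1\<^sup>2) / (2 * d1\<^sup>2) / n"
      "measure (unif_points n) (B2 n) \<le> (c2 + 4 * c2\<^sup>2) / (2 * d2\<^sup>2) / n"
      "measure (unif_points n) (B3 n) \<le> pi * (e n)\<^sup>2 / 0.005"
    if n: "1 \<le> n" for n
    unfolding B1_def B2_def B3_def c1_def c2_def
    by (intro measure_many_close_pairs_le measure_many_near_le n d; simp add: e_def)+
  have Q: "Q n \<in> sets (unif_points n)" for n
  proof -
    have "{x \<in> space (unif_points n). x i \<in> unit_square} \<in> sets (unif_points n)" if "i \<in> {..<n}" for i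
      using measurable_sets[OF measurable_unif_points[of i n] unit_square_borel] that
      by (simp add: vimage_def Int_def conj_commute del: mem_Times_iff)
    then show ?thesis unfolding Q_def by (rule sets.sets_Collect_finite_All[OF _ finite_lessThan])
  qed
  have "measure (unif_points n) (Q n) = 1" for n
  proof -
    interpret M: prob_space "unif_points n" by (rule prob_space_unif_points)
    show ?thesis
      using AE_unif_points_in_square[of n] Q[of n]
      by (subst M.prob_eq_1) (auto simp: Q_def simp del: mem_Times_iff elim!: eventually_mono)
  qed
  note Q1 = this
  have sets_E: "E n \<in> sets (unif_points n)" for n
    using B(1-3)[of n] Q[of n] by (auto simp: E_def large_def)
  have "1 - b n \<le> measure (unif_points n) (E n)" if "large n" for n
  proof -
    interpret M: prob_space "unif_points n" by (rule prob_space_unif_points)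
    have n: "1 \<le> n" using that by (simp add: large_def)
    let ?B = "B1 n \<union> B2 n \<union> B3 n"
    have "M.prob (Q n) \<le> M.prob (E n \<union> ?B)"
      using that B(1-3)[OF n] sets_E[of n] Q[of n] by (intro M.finite_measure_mono) (auto simp: E_def)
    also have "\<dots> \<le> M.prob (E n) + (M.prob (B1 n) + M.prob (B2 n) + M.prob (B3 n))"
      using B(1-3)[OF n] sets_E[of n] measure_Un_le[of "E n" "unif_points n" ?B]
        measure_Un_le[of "B1 n \<union> B2 n" "unif_points n" "B3 n"]
        measure_Un_le[of "B1 n" "unif_points n" "B2 n"]
      by simp
    finally show ?thesis using B(4-6)[OF n] unfolding Q1 b_def by linarith
  qed
  then have lower: "\<forall>\<^sub>F n in sequentially. 1 - b n \<le> measure (unif_points n) (E n)"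
    using eventually_large[of K] by (auto simp: large_def e_def elim!: eventually_mono)
  have upper: "\<forall>\<^sub>F n in sequentially. measure (unif_points n) (E n) \<le> 1"
    by (intro always_eventually allI prob_space.prob_le_1 prob_space_unif_points)
  have "(\<lambda>n. C / real n) \<longlonglongrightarrow> 0" for C by real_asymp
  moreover have "(\<lambda>n. pi * (e n)\<^sup>2 / 0.005) \<longlonglongrightarrow> 0" unfolding e_def by real_asymp
  ultimately have "(\<lambda>n. 1 - b n) \<longlonglongrightarrow> 1 - (0 + 0 + 0)"
    unfolding b_def by (intro tendsto_diff tendsto_add tendsto_const)
  then have lim: "(\<lambda>n. measure (unif_points n) (E n)) \<longlonglongrightarrow> 1"
    using tendsto_sandwich[OF lower upper] by simp
  have "ITP dep (k n) (map x (T n x)) / cvrp_opt dep x n (k n) \<le> 0.915 + \<alpha>"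
    if n: "1 \<le> n" and x: "x \<in> E n" for n x
  proof -
    have large: "large n" and x: "x \<in> Q n" "x \<notin> B1 n" "x \<notin> B2 n" "x \<notin> B3 n"
      using x by (auto simp: E_def split: if_splits)
    have sq: "x i \<in> unit_square" if "i < n" for i using x(1) that unfolding Q_def by blast
    have D: "dist dep (x i) \<le> norm dep + 2" if "i < n" for i
    proof -
      have "norm (x i) \<le> \<bar>fst (x i)\<bar> + \<bar>snd (x i)\<bar>"
        by (simp add: norm_prod_def sqrt_sum_squares_le_sum_abs)
      then have "norm (x i) \<le> 2" using sq[OF that] by (auto simp: mem_Times_iff)
      then show ?thesis using norm_triangle_ineq4[of dep "x i"] by (simp add: dist_norm)
    qed
    have tsp: "tsp_opt dep x n \<le> sqrt 2 * sqrt n + K"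
      unfolding K_def using tsp_opt_le_sqrt[OF n sq D] by simp
    have "ITP dep (k n) (map x (T n x)) \<le> (0.915 + \<alpha>) * cvrp_opt dep x n (k n)"
      using assms(2)[OF n] assms(3)[of n x] x large
      by (intro itp_bound[OF n _ assms(1) _ _ tsp, where e = "e n"])
         (auto simp: large_def Q_def B1_def B2_def B3_def d1_def d2_def e_def)
    moreover have "0 \<le> 1 * cvrp_opt dep x n (k n)"
      by (rule cvrp_opt_ge[OF n]) (use assms(2)[OF n] in \<open>auto intro!: sum_list_nonneg tour_cost_nonneg\<close>)
    \<comment> \<open>If the optimum is 0, the quotient is 0 by the convention for division.\<close>
    ultimately show ?thesis
      using assms(1) by (cases "cvrp_opt dep x n (k n) = 0") (auto simp: divide_le_eq)
  qed
  then show ?thesis using sets_E lim by blast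
qed

end
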